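(* Let $a(t)=(t-2+\frac1t)^3$ and $q=\frac{n+3}{2}$. Then, as $n\to\infty$ (with remainder terms uniform in $j$): 1. For $j\in\{1,\dots,[\frac{n+1}{2}]\}$ with $\frac12 e^{\pi(j-1)}>q^2$, $$\varphi_{2j-1}=d_{1,j}+\frac{2u_1^{\star}}{n+3}+\frac{4u_2^{\star}}{(n+3)^2}+O\left(\frac1{n^3}\right),$$ where $u_1^{\star}=\arctan\left(2\frac{C(d_{1,j})}{\sin(d_{1,j})}\right)$ and $$u_2^{\star}=2\,\frac{C'(d_{1,j})\sin(d_{1,j})-C(d_{1,j})\cos(d_{1,j})}{\sin^2(d_{1,j})+4C^2(d_{1,j})}\,\arctan\left(2\frac{C(d_{1,j})}{\sin(d_{1,j})}\right).$$ 2. For $j\in\{1,\dots,[\frac n2]\}$ with $\frac12 e^{\pi(j-1)}>q^2$, $$\varphi_{2j}=d_{2,j}+\frac{2w_1^{\star}}{n+3}+\frac{4w_2^{\star}}{(n+3)^2}+O\left(\frac1{n^3}\right),$$ where $w_1^{\star}=\arctan\left(2\frac{C(d_{2,j})}{\sin(d_{2,j})}\right)$ and $$w_2^{\star}=2\,\frac{C'(d_{2,j})\sin(d_{2,j})-C(d_{2,j})\cos(d_{2,j})}{\sin^2(d_{2,j})+4C^2(d_{2,j})}\,\arctan\left(2\frac{C(d_{2,j})}{\sin(d_{2,j})}\right).$$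
   Context: $d_{1,j}=\frac{2\pi j}{n+3}$, $d_{2,j}=\frac{(2j+1)\pi}{n+3}$; $[x]$ is the integer part of $x$. $\beta:[0,\pi]\to\mathbb C$ is the regular branch of $\arccos\bigl(1-(1-\cos\varphi)e^{2\pi i/3}\bigr)$ determined as follows: $\beta$ is continuous, $\beta(0)=0$, $\cos\beta(\varphi)=1-(1-\cos\varphi)e^{2\pi i/3}$, and for $\varphi\in(0,\pi)$ one has $\sin\beta(\varphi)=B_s(\varphi)e^{i\psi_s(\varphi)}$ with $B_s(\varphi)>0$ and $\psi_s(\varphi)\in(\frac{\pi}{4},\frac{\pi}{3})$. For $\varphi\in(0,\pi)$ put $c(\varphi)=\Re\beta(\varphi)$, $b(\varphi)=\Im\beta(\varphi)$, $B(\varphi)=\Re\bigl(\sin(\beta(\varphi))e^{-\pi i/3}\bigr)$, $C(\varphi)=-\Im\bigl(\sin(\beta(\varphi))e^{-\pi i/3}\bigr)$, and $$f(\varphi)=2\,\frac{B(\varphi)\sin((n+3)c(\varphi))+C(\varphi)\sinh((n+3)b(\varphi))}{\sin(\varphi)\,\bigl(\cos((n+3)c(\varphi))+\cosh((n+3)b(\varphi))\bigr)},$$ $$h(\varphi)=2\,\frac{B(\varphi)\sin((n+3)c(\varphi))-C(\varphi)\sinh((n+3)b(\varphi))}{\sin(\varphi)\,\bigl(-\cos((n+3)c(\varphi))+\cosh((n+3)b(\varphi))\bigr)}.$$ For $n$ sufficiently large, $\varphi_{2j-1}$ ($1\le j\le[\frac{n+1}{2}]$) denotes the unique root of $\tan(\frac{n+3}{2}\varphi)=f(\varphi)$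 in $\left(\frac{\pi(2j-1)}{n+3},\frac{\pi(2j+1)}{n+3}\right)$, and $\varphi_{2j}$ ($1\le j\le[\frac n2]$) denotes the unique root of $\tan(\frac{n+3}{2}\varphi)=\frac1{h(\varphi)}$ in $\left(\frac{2\pi j}{n+3},\frac{2\pi(j+1)}{n+3}\right)$, the latter equation being understood as $\cos(\frac{n+3}{2}\varphi)=h(\varphi)\sin(\frac{n+3}{2}\varphi)$. (With $g(\varphi)=a(e^{i\varphi})$, the numbers $g(\varphi_m)$, $1\le m\le n$, are the eigenvalues of the $n\times n$ Toeplitz matrix with symbol $a$.) "Uniform in $j$" means that the constant in $O(1/n^3)$ does not depend on $j$. *)

theory Defs
  imports "HOL-Analysis.Analysis"
begin

text \<open>
  The defining properties of the regular branch \<open>\<beta>\<close> of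
  \<open>arccos (1 - (1 - cos \<phi>) e^(2\<pi>i/3))\<close> on \<open>[0, \<pi>]\<close>. They determine the values of
  \<open>\<beta>\<close> on \<open>[0, \<pi>]\<close>; the values elsewhere are irrelevant.
\<close>

definition regular_branch :: "(real \<Rightarrow> complex) \<Rightarrow> bool" where
  "regular_branch \<beta> \<longleftrightarrow>
     continuous_on {0..pi} \<beta> \<and> \<beta> 0 = 0 \<and>
     (\<forall>\<phi>\<in>{0..pi}. cos (\<beta> \<phi>) = 1 - (1 - complex_of_real (cos \<phi>)) * cis (2 * pi / 3)) \<and>
     (\<forall>\<phi>\<in>{0<..<pi}. \<exists>B\<^sub>s \<psi>\<^sub>s. B\<^sub>s > 0 \<and> \<psi>\<^sub>s \<in> {pi / 4<..<pi / 3} \<and>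
        sin (\<beta> \<phi>) = complex_of_real B\<^sub>s * cis \<psi>\<^sub>s)"

definition c_fun :: "(real \<Rightarrow> complex) \<Rightarrow> real \<Rightarrow> real" where
  "c_fun \<beta> \<phi> = Re (\<beta> \<phi>)"

definition b_fun :: "(real \<Rightarrow> complex) \<Rightarrow> real \<Rightarrow> real" where
  "b_fun \<beta> \<phi> = Im (\<beta> \<phi>)"

definition B_fun :: "(real \<Rightarrow> complex) \<Rightarrow> real \<Rightarrow> real" where
  "B_fun \<beta> \<phi> = Re (sin (\<beta> \<phi>) * cis (- pi / 3))"

definition C_fun :: "(real \<Rightarrow> complex) \<Rightarrow> real \<Rightarrow> real" where
  "C_fun \<beta> \<phi> = - Im (sin (\<beta> \<phi>) * cis (- pi / 3))"

definition f_fun :: "(real \<Rightarrow> complex) \<Rightarrow> nat \<Rightarrow> real \<Rightarrow> real" where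
  "f_fun \<beta> n \<phi> =
     2 * ((B_fun \<beta> \<phi> * sin (real (n + 3) * c_fun \<beta> \<phi>) + C_fun \<beta> \<phi> * sinh (real (n + 3) * b_fun \<beta> \<phi>)) /
          (sin \<phi> * (cos (real (n + 3) * c_fun \<beta> \<phi>) + cosh (real (n + 3) * b_fun \<beta> \<phi>))))"

definition h_fun :: "(real \<Rightarrow> complex) \<Rightarrow> nat \<Rightarrow> real \<Rightarrow> real" where
  "h_fun \<beta> n \<phi> =
     2 * ((B_fun \<beta> \<phi> * sin (real (n + 3) * c_fun \<beta> \<phi>) - C_fun \<beta> \<phi> * sinh (real (n + 3) * b_fun \<beta> \<phi>)) /
          (sin \<phi> * (- cos (real (n + 3) * c_fun \<beta> \<phi>) + cosh (real (n + 3) * b_fun \<beta> \<phi>))))"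

text \<open>
  The point \<open>\<phi>\<^sub>m\<close> for the \<open>n \<times> n\<close> matrix. The intervals for odd \<open>m = 2j - 1\<close> and for even
  \<open>m = 2j\<close> are both \<open>(\<pi>m/(n+3), \<pi>(m+2)/(n+3))\<close>. On the odd ones \<open>cos ((n+3)\<phi>/2)\<close> has no
  zero, so the convention \<open>tan x = 0\<close> at poles of \<open>tan\<close> plays no role. The even equation
  is the pole-free form of \<open>tan ((n+3)\<phi>/2) = 1 / h \<phi>\<close>.
\<close>

definition phi :: "(real \<Rightarrow> complex) \<Rightarrow> nat \<Rightarrow> nat \<Rightarrow> real" where
  "phi \<beta> n m = (THE \<phi>. \<phi> \<in> {pi * real m / real (n + 3)<..<pi * real (m + 2) / real (n + 3)} \<and>
     (if odd m then tan (real (n + 3) / 2 * \<phi>) = f_fun \<beta> n \<phi>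
      else cos (real (n + 3) / 2 * \<phi>) = h_fun \<beta> n \<phi> * sin (real (n + 3) / 2 * \<phi>)))"

definition d1 :: "nat \<Rightarrow> nat \<Rightarrow> real" where
  "d1 n j = 2 * pi * real j / real (n + 3)"

definition d2 :: "nat \<Rightarrow> nat \<Rightarrow> real" where
  "d2 n j = (2 * real j + 1) * pi / real (n + 3)"

text \<open>
  The coefficients \<open>u\<^sub>1\<^sup>\<star>, u\<^sub>2\<^sup>\<star>\<close> are these functions at \<open>d = d\<^sub>1\<^sub>,\<^sub>j\<close>, and
  \<open>w\<^sub>1\<^sup>\<star>, w\<^sub>2\<^sup>\<star>\<close> are the same functions at \<open>d = d\<^sub>2\<^sub>,\<^sub>j\<close>.
\<close>

definition coeff1 :: "(real \<Rightarrow> complex) \<Rightarrow> real \<Rightarrow> real" where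
  "coeff1 \<beta> d = arctan (2 * (C_fun \<beta> d / sin d))"

definition coeff2 :: "(real \<Rightarrow> complex) \<Rightarrow> real \<Rightarrow> real" where
  "coeff2 \<beta> d =
     2 * ((deriv (C_fun \<beta>) d * sin d - C_fun \<beta> d * cos d) / ((sin d)\<^sup>2 + 4 * (C_fun \<beta> d)\<^sup>2)) *
     arctan (2 * (C_fun \<beta> d / sin d))"

end

theory Submission
  imports Defs
begin

text \<open>
  Write \<open>N = n + 3\<close>. Solving for the half-angle \<open>N \<phi> / 2\<close>, both equations take the form
  \<open>\<phi> = d + (2 / N) \<theta>(\<phi>)\<close> on the interval \<open>(d - \<pi> / N, d + \<pi> / N)\<close>, with \<open>d = d\<^sub>1\<^sub>,\<^sub>j\<close>,
  \<open>\<theta> = arctan f\<close> in the odd case and \<open>d = d\<^sub>2\<^sub>,\<^sub>j\<close>, \<open>\<theta> = arctan (-h)\<close> in the even case. If \<open>\<theta>\<close> is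
  close to a fixed smooth phase \<open>\<eta>\<close>, then one step of iteration gives
  \<open>\<phi> = d + (2 / N) \<eta>(d) + (4 / N\<^sup>2) \<eta>'(d) \<eta>(d) + O(1/N\<^sup>3)\<close>. The asserted coefficients are those of
  \<open>\<eta> = arctan (2 C / sin)\<close>.
  
  The exact phase depends on the small quantity \<open>z = exp (i N \<beta> \<phi>)\<close>, of modulus \<open>exp (- N Im \<beta>)\<close>:
  by \<open>phase_height_eq\<close>, \<open>f\<close> and \<open>-h\<close> are \<open>Re (i R (1 - \<sigma> z) / (1 + \<sigma> z)) / cos (\<phi>/2)\<close> with
  \<open>\<sigma> = 1\<close> and \<open>\<sigma> = -1\<close>, where \<open>R\<close> is the smooth function \<open>sin_quot\<close>, and \<open>z = 0\<close> gives
  \<open>2 C / sin\<close>. The bound \<open>Im \<beta> \<ge> min (\<phi>/2, 1/2)\<close> of \<open>Im_branch_ge\<close> turns the hypothesis on \<open>j\<close> into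
  \<open>\<bar>z\<bar> \<le> 2 / N\<^sup>2\<close> on the whole interval. This is small enough to change the phase by \<open>O(1/N\<^sup>2)\<close> only
  and, since \<open>\<bar>z'\<bar> \<le> N \<bar>z\<bar>\<close>, to keep it Lipschitz with a fixed constant. So the root
  exists and is unique for large \<open>n\<close> (\<open>perturbed_phase_equation\<close>), and the expansion holds
  (\<open>phase_root_asymptotics\<close>).
  
  The delicate point is uniformity near \<open>\<phi> = \<pi>\<close>, where \<open>2 C / sin\<close> and \<open>f\<close> are unbounded. There the
  phases have to be treated as arguments of the vectors \<open>(cos (\<phi>/2), y)\<close>, with \<open>y = - Im R\<close> for the
  limit phase and \<open>y = Re (i R (1 - \<sigma> z) / (1 + \<sigma> z))\<close> for the exact one. These vectors are smooth up
  to \<open>\<pi>\<close> and stay away from the origin (\<open>half_le_cos_minus_Im_sin_quot\<close>), so the estimates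
  \<open>arctan_quotient_Lipschitz\<close> and \<open>arctan_quotient_Taylor\<close> have constants independent of \<open>\<phi>\<close>.
\<close>

section \<open>The argument of a plane vector: Lipschitz and Taylor estimates\<close>

text \<open>
  \<open>arctan (y / k)\<close> is the argument of \<open>k + i y\<close>, and \<open>Ln\<close> has derivative
  \<open>1 / z\<close>. The two half-planes cut out a convex region that stays away from \<open>0\<close>. The region is
  chosen so that \<open>k\<close> may tend to \<open>0\<close>, where the quotient itself blows up, and so that \<open>y\<close>
  may be slightly negative.
\<close>

lemma arctan_quotient_Lipschitz:
  fixes k\<^sub>1 k\<^sub>2 y\<^sub>1 y\<^sub>2 :: real
  assumes "k\<^sub>1 > 0" "k\<^sub>1 + y\<^sub>1 \<ge> 1/4" "k\<^sub>2 > 0" "k\<^sub>2 + y\<^sub>2 \<ge> 1/4"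
  shows "\<bar>arctan (y\<^sub>1 / k\<^sub>1) - arctan (y\<^sub>2 / k\<^sub>2)\<bar> \<le> 8 * (\<bar>k\<^sub>1 - k\<^sub>2\<bar> + \<bar>y\<^sub>1 - y\<^sub>2\<bar>)"
proof -
  define S where "S = {z. Re z > 0} \<inter> {z. Re z + Im z \<ge> 1/4}"
  have "convex S"
    unfolding S_def
  proof (rule convex_Int)
    show "convex {z. Re z > 0}"
      by (rule convex_halfspace_Re_gt)
    show "convex {z. Re z + Im z \<ge> 1/4}"
      using convex_halfspace_ge[of "1/4" "1 + \<i>"] by (simp add: inner_complex_def)
  qed
  have Ln_deriv: "(Ln has_field_derivative inverse z) (at z within S)" if "z \<in> S" for z
    by (rule has_field_derivative_at_within[OF has_field_derivative_Ln])
      (use that in \<open>auto simp: S_def complex_nonpos_Reals_iff\<close>)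
  have inv_bound: "norm (inverse z) \<le> 8" if "z \<in> S" for z
  proof -
    have "1/4 \<le> \<bar>Re z\<bar> + \<bar>Im z\<bar>"
      using that abs_ge_self[of "Re z"] abs_ge_self[of "Im z"]
      unfolding S_def Int_iff mem_Collect_eq by linarith
    also have "\<dots> \<le> 2 * norm z"
      using abs_Re_le_cmod[of z] abs_Im_le_cmod[of z] by linarith
    finally have "1/8 \<le> norm z"
      by simp
    then show ?thesis
      using le_imp_inverse_le[of "1/8" "norm z"] by (simp add: norm_inverse)
  qed
  have Im_Ln: "Im (Ln z) = arctan (Im z / Re z)" if "Re z > 0" for z
    using that by (metis Arg_eq_Im_Ln arg_conv_arctan order_less_irrefl zero_complex.simps(1))
  have "\<bar>arctan (y\<^sub>1 / k\<^sub>1) - arctan (y\<^sub>2 / k\<^sub>2)\<bar> = \<bar>Im (Ln (Complex k\<^sub>1 y\<^sub>1) - Ln (Complex k\<^sub>2 y\<^sub>2))\<bar>"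
    using assms by (simp add: Im_Ln)
  also have "\<dots> \<le> norm (Ln (Complex k\<^sub>1 y\<^sub>1) - Ln (Complex k\<^sub>2 y\<^sub>2))"
    by (rule abs_Im_le_cmod)
  also have "\<dots> \<le> 8 * norm (Complex k\<^sub>1 y\<^sub>1 - Complex k\<^sub>2 y\<^sub>2)"
    by (rule field_differentiable_bound[OF \<open>convex S\<close> Ln_deriv inv_bound])
      (use assms in \<open>auto simp: S_def\<close>)
  also have "\<dots> \<le> 8 * (\<bar>k\<^sub>1 - k\<^sub>2\<bar> + \<bar>y\<^sub>1 - y\<^sub>2\<bar>)"
    using cmod_le[of "Complex k\<^sub>1 y\<^sub>1 - Complex k\<^sub>2 y\<^sub>2"] by simp
  finally show ?thesis .
qed

text \<open>
  The slope is \<open>(y' k - y k') / (k\<^sup>2 + y\<^sup>2)\<close>, whose denominator is bounded away from \<open>0\<close> even where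
  \<open>k\<close> is small. Hence \<open>arctan (y / k)\<close> has a bounded second derivative on the whole interval.
\<close>

lemma arctan_quotient_Taylor:
  fixes k k' k'' y y' y'' :: "real \<Rightarrow> real" and a b c B :: real
  defines "\<eta>' \<equiv> \<lambda>x. (y' x * k x - y x * k' x) / ((k x)\<^sup>2 + (y x)\<^sup>2)"
  assumes k: "\<And>x. x \<in> {a<..<b} \<Longrightarrow> (k has_real_derivative k' x) (at x)"
    and k': "\<And>x. x \<in> {a<..<b} \<Longrightarrow> (k' has_real_derivative k'' x) (at x)"
    and y: "\<And>x. x \<in> {a<..<b} \<Longrightarrow> (y has_real_derivative y' x) (at x)"
    and y': "\<And>x. x \<in> {a<..<b} \<Longrightarrow> (y' has_real_derivative y'' x) (at x)"
    and pos: "\<And>x. x \<in> {a<..<b} \<Longrightarrow> k x > 0"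
    and c: "c > 0" "\<And>x. x \<in> {a<..<b} \<Longrightarrow> (k x)\<^sup>2 + (y x)\<^sup>2 \<ge> c"
    and B: "\<And>x. x \<in> {a<..<b} \<Longrightarrow> \<bar>k x\<bar> \<le> B \<and> \<bar>k' x\<bar> \<le> B \<and> \<bar>k'' x\<bar> \<le> B"
           "\<And>x. x \<in> {a<..<b} \<Longrightarrow> \<bar>y x\<bar> \<le> B \<and> \<bar>y' x\<bar> \<le> B \<and> \<bar>y'' x\<bar> \<le> B"
  obtains M where
    "\<And>d. d \<in> {a<..<b} \<Longrightarrow> ((\<lambda>x. arctan (y x / k x)) has_real_derivative \<eta>' d) (at d)"
    "\<And>d. d \<in> {a<..<b} \<Longrightarrow> \<bar>\<eta>' d\<bar> \<le> M"
    "\<And>d x. d \<in> {a<..<b} \<Longrightarrow> x \<in> {a<..<b} \<Longrightarrow>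
       \<bar>arctan (y x / k x) - arctan (y d / k d) - \<eta>' d * (x - d)\<bar> \<le> M * (x - d)\<^sup>2"
proof -
  define \<eta> where "\<eta> = (\<lambda>x. arctan (y x / k x))"
  define num num' den den' where "num = (\<lambda>x. y' x * k x - y x * k' x)"
    and "num' = (\<lambda>x. y'' x * k x - y x * k'' x)"
    and "den = (\<lambda>x. (k x)\<^sup>2 + (y x)\<^sup>2)" and "den' = (\<lambda>x. 2 * (k x * k' x + y x * y' x))"
  define M where "M = 2 * B\<^sup>2 / c + 2 * B\<^sup>2 * (4 * B\<^sup>2) / c\<^sup>2"
  have \<eta>'_eq: "\<eta>' = (\<lambda>x. num x / den x)"
    by (simp add: \<eta>'_def num_def den_def)
  have den: "den x \<ge> c" if "x \<in> {a<..<b}" for x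
    using c(2)[OF that] by (simp add: den_def)
  have prod: "\<bar>u * v\<bar> \<le> B\<^sup>2" if "\<bar>u\<bar> \<le> B" "\<bar>v\<bar> \<le> B" for u v
    unfolding abs_mult power2_eq_square using that by (intro mult_mono) auto
  have num: "\<bar>num x\<bar> \<le> 2 * B\<^sup>2" if "x \<in> {a<..<b}" for x
    using prod[of "y' x" "k x"] prod[of "y x" "k' x"] B(1)[OF that] B(2)[OF that]
    unfolding num_def by linarith
  have num': "\<bar>num' x\<bar> \<le> 2 * B\<^sup>2" if "x \<in> {a<..<b}" for x
    using prod[of "y'' x" "k x"] prod[of "y x" "k'' x"] B(1)[OF that] B(2)[OF that]
    unfolding num'_def by linarith
  have den': "\<bar>den' x\<bar> \<le> 4 * B\<^sup>2" if "x \<in> {a<..<b}" for x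
  proof -
    have "\<bar>k x * k' x\<bar> \<le> B\<^sup>2" "\<bar>y x * y' x\<bar> \<le> B\<^sup>2"
      using prod B(1)[OF that] B(2)[OF that] by auto
    then show ?thesis
      unfolding den'_def by (simp add: abs_le_iff)
  qed
  have \<eta>: "(\<eta> has_real_derivative \<eta>' x) (at x)" if "x \<in> {a<..<b}" for x
  proof -
    have "(\<eta> has_real_derivative inverse (1 + (y x / k x)\<^sup>2) * ((y' x * k x - y x * k' x) / (k x * k x))) (at x)"
      unfolding \<eta>_def using pos[OF that]
      by (intro DERIV_chain2[OF DERIV_arctan] DERIV_divide k y that) auto
    also have "inverse (1 + (y x / k x)\<^sup>2) * ((y' x * k x - y x * k' x) / (k x * k x)) = \<eta>' x"
    proof -
      have "1 + (y x / k x)\<^sup>2 = den x / (k x * k x)"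
        using pos[OF that] by (simp add: den_def field_simps power2_eq_square)
      then show ?thesis
        using pos[OF that] den[OF that] c(1) by (simp add: \<eta>'_eq num_def)
    qed
    finally show ?thesis .
  qed
  have \<eta>'_le: "\<bar>\<eta>' x\<bar> \<le> M" if "x \<in> {a<..<b}" for x
  proof -
    have "\<bar>\<eta>' x\<bar> = \<bar>num x\<bar> / den x"
      using den[OF that] c(1) by (simp add: \<eta>'_eq)
    also have "\<dots> \<le> 2 * B\<^sup>2 / c"
      using num[OF that] den[OF that] c(1) by (intro frac_le) auto
    also have "\<dots> \<le> M"
      using c(1) by (simp add: M_def)
    finally show ?thesis .
  qed
  define \<eta>'' where "\<eta>'' = (\<lambda>x. (num' x * den x - num x * den' x) / (den x * den x))"
  have \<eta>''_deriv: "(\<eta>' has_real_derivative \<eta>'' x) (at x)" if "x \<in> {a<..<b}" for x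
  proof -
    have "(num has_real_derivative (y'' x * k x + k' x * y' x) - (y' x * k' x + k'' x * y x)) (at x)"
      unfolding num_def by (intro DERIV_diff DERIV_mult k k' y y' that)
    then have "(num has_real_derivative num' x) (at x)"
      by (simp add: num'_def algebra_simps)
    moreover have "(den has_real_derivative (k' x * k x + k' x * k x) + (y' x * y x + y' x * y x)) (at x)"
      unfolding den_def power2_eq_square by (intro DERIV_add DERIV_mult k y that)
    then have "(den has_real_derivative den' x) (at x)"
      by (simp add: den'_def algebra_simps)
    ultimately show ?thesis
      unfolding \<eta>'_eq \<eta>''_def using den[OF that] c(1) by (intro DERIV_divide) auto
  qed
  have \<eta>''_le: "\<bar>\<eta>'' x\<bar> \<le> M" if "x \<in> {a<..<b}" for x
  proof -
    have d: "den x > 0"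
      using den[OF that] c(1) by linarith
    have "\<eta>'' x = num' x / den x - num x * den' x / (den x)\<^sup>2"
      using d by (simp add: \<eta>''_def diff_divide_distrib power2_eq_square)
    also have "\<bar>\<dots>\<bar> \<le> \<bar>num' x\<bar> / den x + \<bar>num x\<bar> * \<bar>den' x\<bar> / (den x)\<^sup>2"
      using d abs_triangle_ineq4[of "num' x / den x" "num x * den' x / (den x)\<^sup>2"] by (simp add: abs_mult)
    also have "\<dots> \<le> 2 * B\<^sup>2 / c + 2 * B\<^sup>2 * (4 * B\<^sup>2) / c\<^sup>2"
    proof (rule add_mono)
      show "\<bar>num' x\<bar> / den x \<le> 2 * B\<^sup>2 / c"
        by (rule frac_le) (use num'[OF that] den[OF that] c(1) in auto)
      have "\<bar>num x\<bar> * \<bar>den' x\<bar> \<le> 2 * B\<^sup>2 * (4 * B\<^sup>2)"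
        by (rule mult_mono[OF num[OF that] den'[OF that]]) auto
      moreover have "c\<^sup>2 \<le> (den x)\<^sup>2"
        using den[OF that] c(1) by (intro power_mono) auto
      ultimately show "\<bar>num x\<bar> * \<bar>den' x\<bar> / (den x)\<^sup>2 \<le> 2 * B\<^sup>2 * (4 * B\<^sup>2) / c\<^sup>2"
        by (intro frac_le) (use c(1) in auto)
    qed
    finally show ?thesis
      by (simp add: M_def)
  qed
  have taylor: "\<bar>\<eta> x - \<eta> d - \<eta>' d * (x - d)\<bar> \<le> M * (x - d)\<^sup>2"
    if d: "d \<in> {a<..<b}" and x: "x \<in> {a<..<b}" for d x
  proof -
    define S where "S = closed_segment d x"
    have S: "S \<subseteq> {a<..<b}" "convex S" "d \<in> S" "x \<in> S"
      unfolding S_def using closed_segment_subset[OF d x] by auto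
    have M: "M \<ge> 0"
      using \<eta>'_le[OF d] by linarith
    have "\<bar>\<eta>' u - \<eta>' d\<bar> \<le> M * \<bar>x - d\<bar>" if u: "u \<in> S" for u
    proof -
      have "norm (\<eta>' u - \<eta>' d) \<le> M * norm (u - d)"
      proof (rule field_differentiable_bound[of "{a<..<b}"])
        show "(\<eta>' has_real_derivative \<eta>'' z) (at z within {a<..<b})" if "z \<in> {a<..<b}" for z
          by (rule has_field_derivative_at_within[OF \<eta>''_deriv[OF that]])
      qed (use u d S \<eta>''_le in auto)
      moreover have "norm (u - d) \<le> norm (x - d)"
        using u unfolding S_def by (metis dist_commute dist_in_closed_segment dist_norm)
      ultimately show ?thesis
        using M mult_left_mono[of "norm (u - d)" "norm (x - d)" M] by simp
    qed
    note slope = this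
    \<comment> \<open>mean value inequality for \<open>\<eta> u - \<eta>' d * u\<close>, whose slope vanishes at \<open>d\<close>\<close>
    have "norm ((\<eta> x - \<eta>' d * x) - (\<eta> d - \<eta>' d * d)) \<le> (M * \<bar>x - d\<bar>) * norm (x - d)"
    proof (rule field_differentiable_bound[OF S(2)])
      show "((\<lambda>u. \<eta> u - \<eta>' d * u) has_real_derivative \<eta>' z - \<eta>' d) (at z within S)" if "z \<in> S" for z
      proof -
        have "((\<lambda>u. \<eta> u - \<eta>' d * u) has_real_derivative \<eta>' z - \<eta>' d * 1) (at z)"
          using that S(1) by (intro DERIV_diff \<eta> DERIV_cmult DERIV_ident) auto
        then show ?thesis
          by (simp add: has_field_derivative_at_within)
      qed
    qed (use S slope in auto)
    then show ?thesis
      by (simp add: algebra_simps power2_eq_square abs_mult_self_eq flip: abs_mult)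
  qed
  show ?thesis
    using that[of M] \<eta> \<eta>'_le taylor unfolding \<eta>_def by blast
qed

section \<open>Fixed-point equations with a slowly varying phase\<close>

text \<open>
  Existence is the intermediate value theorem: the correction \<open>2 \<theta> / N\<close> is smaller than the
  half-length \<open>\<pi> / N\<close> of the interval. Uniqueness holds because the right-hand side has Lipschitz
  constant \<open>2 L / N < 1\<close>.
\<close>

lemma unique_root_phase_equation:
  fixes N d L :: real and \<theta> :: "real \<Rightarrow> real"
  assumes N: "N > 0" and L: "2 * L < N"
    and bound: "\<And>x. x \<in> {d - pi / N..d + pi / N} \<Longrightarrow> \<bar>\<theta> x\<bar> < pi / 2"
    and Lip: "\<And>x y. x \<in> {d - pi / N..d + pi / N} \<Longrightarrow> y \<in> {d - pi / N..d + pi / N} \<Longrightarrow>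
                \<bar>\<theta> x - \<theta> y\<bar> \<le> L * \<bar>x - y\<bar>"
  shows "\<exists>!x. x \<in> {d - pi / N<..<d + pi / N} \<and> x = d + 2 / N * \<theta> x"
proof -
  let ?I = "{d - pi / N..d + pi / N}"
  define g where "g = (\<lambda>x. x - (d + 2 / N * \<theta> x))"
  have step: "\<bar>2 / N * \<theta> x\<bar> < pi / N" if "x \<in> ?I" for x
    using bound[OF that] N by (simp add: abs_mult field_simps)
  have L0: "L \<ge> 0"
    using Lip[of "d - pi / N" d] N pi_gt_zero by (smt (verit) atLeastAtMost_iff divide_pos_pos mult_neg_pos)
  have "L-lipschitz_on ?I \<theta>"
    using L0 Lip by (auto simp: lipschitz_on_def dist_real_def)
  then have cont: "continuous_on ?I g"
    unfolding g_def by (intro continuous_intros lipschitz_on_continuous_on)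
  have ends: "d - pi / N \<in> ?I" "d + pi / N \<in> ?I" "d - pi / N \<le> d + pi / N"
    using N pi_gt_zero by (auto intro: order_trans[of _ 0])
  have "g (d - pi / N) \<le> 0" "0 \<le> g (d + pi / N)"
    using step[OF ends(1)] step[OF ends(2)] unfolding g_def by linarith+
  then obtain x where x: "x \<in> ?I" "g x = 0"
    using IVT'[of g _ 0, OF _ _ ends(3) cont] by auto
  show ?thesis
  proof (rule ex1I[of _ x])
    show "x \<in> {d - pi / N<..<d + pi / N} \<and> x = d + 2 / N * \<theta> x"
      using x step[OF x(1)] unfolding g_def abs_less_iff greaterThanLessThan_iff by linarith
    fix y assume y: "y \<in> {d - pi / N<..<d + pi / N} \<and> y = d + 2 / N * \<theta> y"
    have "y - x = 2 / N * (\<theta> y - \<theta> x)"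
      using x(2) y by (simp add: g_def right_diff_distrib)
    then have "\<bar>y - x\<bar> = 2 / N * \<bar>\<theta> y - \<theta> x\<bar>"
      using N by (simp only: abs_mult abs_divide abs_numeral abs_of_pos)
    also have "\<dots> \<le> 2 / N * (L * \<bar>y - x\<bar>)"
      using Lip[of y x] x y N by (intro mult_left_mono) auto
    finally have "\<bar>y - x\<bar> * (1 - 2 * L / N) \<le> 0"
      by (simp add: algebra_simps)
    moreover have "1 - 2 * L / N > 0"
      using L N by simp
    ultimately show "y = x"
      by (simp add: mult_le_0_iff)
  qed
qed

text \<open>
  One step of fixed-point iteration. In the application \<open>t\<close> is the exact phase at the root \<open>x\<close>, while
  \<open>\<eta>d\<close> and \<open>\<eta>x\<close> are the values of a limit phase at \<open>d\<close> and at \<open>x\<close>, and \<open>\<eta>'\<close> is its slope at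
  \<open>d\<close>. Crudely \<open>x - d = 2 \<eta>d / N + O(1/N\<^sup>2)\<close>; feeding this into the linear Taylor term of the
  phase gives the second-order coefficient \<open>4 \<eta>' \<eta>d\<close>.
\<close>

lemma phase_equation_expansion:
  fixes N d x t \<eta>d \<eta>x \<eta>' A M :: real
  assumes N: "N \<ge> 1" and x: "x = d + 2 / N * t" and t: "\<bar>t\<bar> \<le> pi / 2"
    and approx: "\<bar>t - \<eta>x\<bar> \<le> A / N\<^sup>2"
    and taylor: "\<bar>\<eta>x - \<eta>d - \<eta>' * (x - d)\<bar> \<le> M * (x - d)\<^sup>2"
    and deriv: "\<bar>\<eta>'\<bar> \<le> M"
  shows "\<bar>x - (d + 2 * \<eta>d / N + 4 * (\<eta>' * \<eta>d) / N\<^sup>2)\<bar> \<le>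
           2 * (A + M * pi\<^sup>2 + 2 * M * (A + M * pi\<^sup>2 + M * pi)) / N ^ 3"
proof -
  have M: "M \<ge> 0"
    using deriv by linarith
  have A: "A \<ge> 0"
    using approx N by (smt (verit) divide_neg_pos zero_less_power)
  have dist: "\<bar>x - d\<bar> \<le> pi / N"
    using t N by (simp add: x abs_mult field_simps)
  have "(x - d)\<^sup>2 \<le> (pi / N)\<^sup>2"
    using dist by (metis abs_ge_zero power2_abs power_mono)
  then have sq: "M * (x - d)\<^sup>2 \<le> M * pi\<^sup>2 / N\<^sup>2"
    using M by (metis mult_left_mono power_divide times_divide_eq_right)
  have lin: "\<bar>\<eta>' * (x - d)\<bar> \<le> M * pi / N"
    using mult_mono[OF deriv dist M abs_ge_zero] by (simp add: abs_mult)
  have sq_le: "c / N\<^sup>2 \<le> c / N" if "c \<ge> 0" for c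
    using N that by (intro divide_left_mono) (auto simp: power2_eq_square)
  have "\<bar>t - \<eta>d\<bar> \<le> A / N\<^sup>2 + M * pi\<^sup>2 / N\<^sup>2 + M * pi / N"
    using approx taylor sq lin by linarith
  also have "\<dots> \<le> A / N + M * pi\<^sup>2 / N + M * pi / N"
    using sq_le[OF A] sq_le[of "M * pi\<^sup>2"] M by simp
  finally have crude: "\<bar>t - \<eta>d\<bar> \<le> (A + M * pi\<^sup>2 + M * pi) / N"
    by (simp add: add_divide_distrib)
  have double_quotient: "M * (2 / N * (Q / N)) = 2 * M * Q / N\<^sup>2" for Q
    by (simp add: power2_eq_square)
  have "\<bar>\<eta>' * (2 / N * (t - \<eta>d))\<bar> = \<bar>\<eta>'\<bar> * (2 / N * \<bar>t - \<eta>d\<bar>)"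
    unfolding abs_mult using N by simp
  also have "\<dots> \<le> M * (2 / N * ((A + M * pi\<^sup>2 + M * pi) / N))"
    using crude deriv M N by (intro mult_mono mult_left_mono) auto
  finally have feedback: "\<bar>\<eta>' * (2 / N * (t - \<eta>d))\<bar> \<le> 2 * M * (A + M * pi\<^sup>2 + M * pi) / N\<^sup>2"
    by (simp only: double_quotient)
  have "x - (d + 2 * \<eta>d / N + 4 * (\<eta>' * \<eta>d) / N\<^sup>2) =
      2 / N * ((t - \<eta>x) + (\<eta>x - \<eta>d - \<eta>' * (x - d)) + \<eta>' * (2 / N * (t - \<eta>d)))"
    unfolding x by (simp add: divide_inverse power2_eq_square algebra_simps)
  also have "\<bar>\<dots>\<bar> = 2 / N * \<bar>(t - \<eta>x) + (\<eta>x - \<eta>d - \<eta>' * (x - d)) + \<eta>' * (2 / N * (t - \<eta>d))\<bar>"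
    unfolding abs_mult using N by simp
  also have "\<dots> \<le> 2 / N * (A / N\<^sup>2 + M * pi\<^sup>2 / N\<^sup>2 + 2 * M * (A + M * pi\<^sup>2 + M * pi) / N\<^sup>2)"
    using approx taylor sq feedback N by (intro mult_left_mono divide_nonneg_nonneg) linarith+
  also have "\<dots> = 2 * (A + M * pi\<^sup>2 + 2 * M * (A + M * pi\<^sup>2 + M * pi)) / N ^ 3"
    by (simp add: power2_eq_square power3_eq_cube add_divide_distrib distrib_left)
  finally show ?thesis .
qed

section \<open>The quotient of the sine along the branch by the half-angle sine\<close>

text \<open>
  Along the branch, \<open>sin_quot \<phi>\<close> is \<open>sin (\<beta> \<phi>) e^(-\<pi>i/3) / sin (\<phi>/2)\<close>. The radicand has real part
  at least \<open>4\<close>, so this quotient is smooth for all real \<open>\<phi>\<close>, and in particular up to both end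
  points \<open>0\<close> and \<open>\<pi>\<close>.
\<close>

definition sin_quot :: "real \<Rightarrow> complex" where
  "sin_quot \<phi> = csqrt (4 - 2 * (1 - complex_of_real (cos \<phi>)) * cis (2 * pi / 3))"

lemma cis_120: "cis (2 * pi / 3) = Complex (- 1 / 2) (sqrt 3 / 2)"
proof -
  have "cos (2 * pi / 3) = - cos (pi / 3)" "sin (2 * pi / 3) = sin (pi / 3)"
    using cos_pi_minus[of "pi / 3"] sin_pi_minus[of "pi / 3"] by (simp_all add: field_simps)
  then show ?thesis
    by (simp add: complex_eq_iff cos_60 sin_60)
qed

lemma sin_quot_square:
  "(sin_quot \<phi>)\<^sup>2 = 4 - 2 * (1 - complex_of_real (cos \<phi>)) * cis (2 * pi / 3)"
  by (simp add: sin_quot_def)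

lemma Re_sin_quot_square: "(Re (sin_quot \<phi>))\<^sup>2 - (Im (sin_quot \<phi>))\<^sup>2 = 5 - cos \<phi>"
  using arg_cong[OF sin_quot_square[of \<phi>], of Re] by (simp add: cis_120 Re_power2)

lemma Im_sin_quot_square: "2 * Re (sin_quot \<phi>) * Im (sin_quot \<phi>) = - sqrt 3 * (1 - cos \<phi>)"
  using arg_cong[OF sin_quot_square[of \<phi>], of Im] by (simp add: cis_120 Im_power2)

lemma Re_sin_quot_ge: "Re (sin_quot \<phi>) \<ge> 2"
proof -
  have "2\<^sup>2 \<le> (Re (sin_quot \<phi>))\<^sup>2"
    unfolding power2_eq_square[of "2::real"] using Re_sin_quot_square[of \<phi>] cos_le_one[of \<phi>] zero_le_power2[of "Im (sin_quot \<phi>)"]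
    by linarith
  moreover have "Re (sin_quot \<phi>) \<ge> 0"
    using csqrt_principal[of "4 - 2 * (1 - complex_of_real (cos \<phi>)) * cis (2 * pi / 3)"]
    by (auto simp: sin_quot_def)
  ultimately show ?thesis
    by (rule power2_le_imp_le)
qed

lemma norm_sin_quot_ge: "norm (sin_quot \<phi>) \<ge> 2"
  using Re_sin_quot_ge[of \<phi>] complex_Re_le_cmod[of "sin_quot \<phi>"] by linarith

lemma norm_sin_quot_le: "norm (sin_quot \<phi>) \<le> 3"
proof -
  have "(norm (sin_quot \<phi>))\<^sup>2 = norm ((sin_quot \<phi>)\<^sup>2)"
    by (simp add: norm_power)
  also have "\<dots> \<le> norm (4::complex) + norm (2 * (1 - complex_of_real (cos \<phi>)) * cis (2 * pi / 3))"
    unfolding sin_quot_square by (rule norm_triangle_ineq4)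
  also have "norm (2 * (1 - complex_of_real (cos \<phi>)) * cis (2 * pi / 3)) = 2 * (1 - cos \<phi>)"
    using norm_of_real[of "2 * (1 - cos \<phi>)", where 'a = complex] cos_le_one[of \<phi>]
    by (simp add: norm_mult del: norm_of_real)
  also have "norm (4::complex) + 2 * (1 - cos \<phi>) \<le> 3\<^sup>2"
    using cos_ge_minus_one[of \<phi>] by (simp add: algebra_simps del: cos_ge_minus_one)
  finally show ?thesis
    by (rule power2_le_imp_le) simp
qed

lemma sin_quot_nonzero [simp]: "sin_quot \<phi> \<noteq> 0"
  using norm_sin_quot_ge[of \<phi>] by auto

lemma sin_quot_has_vector_derivative:
  "(sin_quot has_vector_derivative - cis (2 * pi / 3) * of_real (sin \<phi>) / sin_quot \<phi>) (at \<phi>)"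
proof -
  let ?w = "\<lambda>\<phi>. 4 - 2 * (1 - complex_of_real (cos \<phi>)) * cis (2 * pi / 3)"
  have inner: "(?w has_vector_derivative - 2 * of_real (sin \<phi>) * cis (2 * pi / 3)) (at \<phi>)"
    by (auto intro!: derivative_eq_intros)
  have "Re (?w \<phi>) > 0"
    using cos_le_one[of \<phi>] by (simp add: cis_120 diff_divide_distrib del: cos_le_one) 
  then have "?w \<phi> \<notin> \<real>\<^sub>\<le>\<^sub>0"
    by (simp add: complex_nonpos_Reals_iff)
  then have outer: "(csqrt has_field_derivative inverse (2 * csqrt (?w \<phi>))) (at (?w \<phi>))"
    by (rule has_field_derivative_csqrt)
  have eq: "csqrt \<circ> ?w = sin_quot"
    by (auto simp: sin_quot_def)
  have val: "- 2 * of_real (sin \<phi>) * cis (2 * pi / 3) * inverse (2 * csqrt (?w \<phi>)) =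
      - cis (2 * pi / 3) * of_real (sin \<phi>) / sin_quot \<phi>"
    by (simp add: sin_quot_def field_simps)
  show ?thesis
    using field_vector_diff_chain_at[OF inner outer] unfolding eq val .
qed

section \<open>The regular branch\<close>

lemma half_angle_identities:
  fixes \<phi> :: real
  shows "sin \<phi> = 2 * sin (\<phi> / 2) * cos (\<phi> / 2)" "1 - cos \<phi> = 2 * (sin (\<phi> / 2))\<^sup>2"
  using sin_double[of "\<phi> / 2"] cos_double_sin[of "\<phi> / 2"] by simp_all

lemma half_angle_pos:
  assumes "\<phi> \<in> {0<..<pi}"
  shows "sin (\<phi> / 2) > 0" "cos (\<phi> / 2) > 0" "sin \<phi> > 0"
  using assms by (auto intro!: sin_gt_zero cos_gt_zero)

lemma cis_60_square: "(cis (pi / 3))\<^sup>2 = cis (2 * pi / 3)"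
  by (simp add: power2_eq_square cis_mult)

context
  fixes \<beta> :: "real \<Rightarrow> complex"
  assumes branch: "regular_branch \<beta>"
begin

lemma cos_branch:
  assumes "\<phi> \<in> {0<..<pi}"
  shows "cos (\<beta> \<phi>) = 1 - 2 * (of_real (sin (\<phi> / 2)))\<^sup>2 * cis (2 * pi / 3)"
proof -
  have "cos (\<beta> \<phi>) = 1 - of_real (1 - cos \<phi>) * cis (2 * pi / 3)"
    using branch assms by (simp add: regular_branch_def)
  then show ?thesis
    unfolding half_angle_identities(2) by simp
qed

text \<open>
  The cosine determines \<open>sin (\<beta> \<phi>)\<close> up to sign. The sign is fixed by the argument condition of the
  regular branch: after rotation by \<open>-\<pi>/3\<close> both \<open>sin (\<beta> \<phi>)\<close> and the right-hand side lie in the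
  right half-plane.
\<close>

lemma sin_branch:
  assumes \<phi>: "\<phi> \<in> {0<..<pi}"
  shows "sin (\<beta> \<phi>) = cis (pi / 3) * of_real (sin (\<phi> / 2)) * sin_quot \<phi>"
proof -
  let ?v = "cis (pi / 3) * of_real (sin (\<phi> / 2)) * sin_quot \<phi>"
  obtain Bs \<psi> where Bs: "Bs > 0" and \<psi>: "\<psi> \<in> {pi / 4<..<pi / 3}"
    and sin_eq: "sin (\<beta> \<phi>) = of_real Bs * cis \<psi>"
    using branch \<phi> unfolding regular_branch_def by blast
  define w where "w = cis (2 * pi / 3)"
  have quot: "(sin_quot \<phi>)\<^sup>2 = 4 - 4 * (of_real (sin (\<phi> / 2)))\<^sup>2 * w"
    unfolding sin_quot_square w_def
    using arg_cong[OF half_angle_identities(2)[of \<phi>], of complex_of_real] by simp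
  have "(sin (\<beta> \<phi>))\<^sup>2 = 1 - (cos (\<beta> \<phi>))\<^sup>2"
    using sin_cos_squared_add[of "\<beta> \<phi>"] by (simp add: eq_diff_eq)
  also have "\<dots> = w * (of_real (sin (\<phi> / 2)))\<^sup>2 * (sin_quot \<phi>)\<^sup>2"
    unfolding cos_branch[OF \<phi>] quot w_def[symmetric] by algebra
  also have "\<dots> = ?v\<^sup>2"
    by (simp add: power_mult_distrib cis_60_square w_def)
  finally have "sin (\<beta> \<phi>) = ?v \<or> sin (\<beta> \<phi>) = - ?v"
    by (simp only: power2_eq_iff)
  moreover have "sin (\<beta> \<phi>) \<noteq> - ?v"
  proof
    assume "sin (\<beta> \<phi>) = - ?v"
    then have "cis (- pi / 3) * sin (\<beta> \<phi>) = - (cis (- pi / 3) * cis (pi / 3)) * of_real (sin (\<phi> / 2)) * sin_quot \<phi>"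
      by simp
    then have "of_real Bs * cis (\<psi> - pi / 3) = - of_real (sin (\<phi> / 2)) * sin_quot \<phi>"
      by (simp add: sin_eq cis_mult mult.left_commute)
    from arg_cong[OF this, of Re]
    have "Bs * cos (\<psi> - pi / 3) = - (sin (\<phi> / 2) * Re (sin_quot \<phi>))"
      by simp
    moreover have "Bs * cos (\<psi> - pi / 3) > 0"
      using Bs \<psi> by (intro mult_pos_pos cos_gt_zero_pi) auto
    moreover have "sin (\<phi> / 2) * Re (sin_quot \<phi>) > 0"
      using half_angle_pos[OF \<phi>] Re_sin_quot_ge[of \<phi>] by (intro mult_pos_pos) auto
    ultimately show False
      by linarith
  qed
  ultimately show ?thesis
    by blast
qed

lemma B_fun_eq: "B_fun \<beta> \<phi> = sin (\<phi> / 2) * Re (sin_quot \<phi>)"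
  and C_fun_eq: "C_fun \<beta> \<phi> = - (sin (\<phi> / 2) * Im (sin_quot \<phi>))"
  if "\<phi> \<in> {0<..<pi}"
proof -
  have "sin (\<beta> \<phi>) * cis (- pi / 3) = (cis (pi / 3) * cis (- pi / 3)) * of_real (sin (\<phi> / 2)) * sin_quot \<phi>"
    unfolding sin_branch[OF that] by simp
  also have "\<dots> = of_real (sin (\<phi> / 2)) * sin_quot \<phi>"
    by (simp add: cis_mult)
  finally show "B_fun \<beta> \<phi> = sin (\<phi> / 2) * Re (sin_quot \<phi>)" "C_fun \<beta> \<phi> = - (sin (\<phi> / 2) * Im (sin_quot \<phi>))"
    by (simp_all add: B_fun_def C_fun_def)
qed

text \<open>
  The argument condition makes \<open>sin (Re \<beta>)\<close> positive, and then the negative imaginary part of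
  \<open>cos (\<beta> \<phi>)\<close> forces \<open>sinh (Im \<beta>)\<close> to be positive.
\<close>

lemma Im_branch_pos:
  assumes \<phi>: "\<phi> \<in> {0<..<pi}"
  shows "Im (\<beta> \<phi>) > 0"
proof -
  obtain Bs \<psi> where Bs: "Bs > 0" and \<psi>: "\<psi> \<in> {pi / 4<..<pi / 3}"
    and sin_eq: "sin (\<beta> \<phi>) = of_real Bs * cis \<psi>"
    using branch \<phi> unfolding regular_branch_def by blast
  have "0 < Re (sin (\<beta> \<phi>))"
    using Bs \<psi> by (auto simp: sin_eq intro!: mult_pos_pos cos_gt_zero_pi)
  then have "0 < sin (Re (\<beta> \<phi>)) * (exp (Im (\<beta> \<phi>)) + exp (- Im (\<beta> \<phi>)))"
    by (simp add: Re_sin)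
  then have sin_pos: "sin (Re (\<beta> \<phi>)) > 0"
    by (simp add: zero_less_mult_iff add_pos_pos) (smt (verit) exp_gt_zero)
  have "Im (cos (\<beta> \<phi>)) = - ((sin (\<phi> / 2))\<^sup>2 * sqrt 3)"
    unfolding cos_branch[OF \<phi>] by (simp add: cis_120 flip: of_real_power)
  also have "\<dots> < 0"
    using half_angle_pos[OF \<phi>] by simp
  finally have "sin (Re (\<beta> \<phi>)) * (exp (- Im (\<beta> \<phi>)) - exp (Im (\<beta> \<phi>))) < 0"
    by (simp add: Im_cos)
  then have "exp (- Im (\<beta> \<phi>)) < exp (Im (\<beta> \<phi>))"
    using sin_pos by (simp add: mult_less_0_iff)
  then show ?thesis
    by simp
qed

end

text \<open>
  To second order the two sides are \<open>1 + t\<^sup>2 / 2\<close> and \<open>1 + t\<^sup>2\<close>, so linear bounds for \<open>sin t\<close> and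
  \<open>sinh (t / 2)\<close> with crude constants suffice on this interval.
\<close>

lemma cosh_le_one_plus_sin_square:
  fixes t :: real
  assumes t: "0 \<le> t" "t \<le> 1 / 2"
  shows "cosh t \<le> 1 + (sin t)\<^sup>2"
proof -
  have cos_ge: "cos x \<ge> 7 / 8" if "0 \<le> x" "x \<le> 1 / 2" for x :: real
  proof -
    have "\<bar>sin (x / 2)\<bar> \<le> 1 / 4"
      using abs_sin_x_le_abs_x[of "x / 2"] that by simp
    then have "(sin (x / 2))\<^sup>2 \<le> (1 / 4)\<^sup>2"
      by (metis abs_ge_zero power2_abs power_mono)
    then show ?thesis
      using half_angle_identities(2)[of x] by (simp add: power2_eq_square)
  qed
  have "7 / 8 * t \<le> sin t"
  proof -
    have "sin 0 - 7 / 8 * 0 \<le> sin t - 7 / 8 * t"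
      by (rule DERIV_nonneg_imp_nondecreasing[OF t(1)])
        (use t cos_ge in \<open>auto intro!: exI derivative_eq_intros\<close>)
    then show ?thesis
      by simp
  qed
  have cosh_le: "cosh x \<le> 6 / 5" if "0 \<le> x" "x \<le> 1 / 4" for x :: real
  proof -
    have "cosh x \<le> cosh (1 / 4)"
      using that by (subst cosh_real_nonneg_le_iff) auto
    also have "cosh (1 / 4) \<le> (6 / 5 :: real)"
    proof -
      have "(1 / 2) * exp (1 / 4) \<le> (1 / 2) * (21 / 16 :: real)"
        using exp_bound[of "1 / 4"] by (simp add: power2_eq_square)
      moreover have "(1 / 2) * exp (- (1 / 4)) \<le> (1 / 2) * (1 :: real)"
        by (rule mult_left_mono) auto
      ultimately have "(1 / 2) * exp (1 / 4) + (1 / 2) * exp (- (1 / 4)) \<le> (1 / 2) * (21 / 16) + (1 / 2) * (1 :: real)"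
        by (rule add_mono)
      then show ?thesis
        by (simp add: cosh_field_def add_divide_distrib)
    qed
    finally show ?thesis .
  qed
  have "sinh (t / 2) \<le> 6 / 5 * (t / 2)"
  proof -
    have "6 / 5 * 0 - sinh 0 \<le> 6 / 5 * (t / 2) - sinh (t / 2)"
      by (rule DERIV_nonneg_imp_nondecreasing[of 0 "t / 2"])
        (use t cosh_le in \<open>auto intro!: exI derivative_eq_intros\<close>)
    then show ?thesis
      by simp
  qed
  then have "(sinh (t / 2))\<^sup>2 \<le> (6 / 5 * (t / 2))\<^sup>2"
    using t by (intro power_mono) auto
  then have "cosh t \<le> 1 + 2 * (6 / 5 * (t / 2))\<^sup>2"
    using cosh_double[of "t / 2"] by (simp add: cosh_square_eq)
  also have "\<dots> \<le> 1 + (7 / 8 * t)\<^sup>2"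
    by (simp add: power2_eq_square)
  also have "\<dots> \<le> 1 + (sin t)\<^sup>2"
    using \<open>7 / 8 * t \<le> sin t\<close> t by (intro add_left_mono power_mono) auto
  finally show ?thesis .
qed

context
  fixes \<beta> :: "real \<Rightarrow> complex"
  assumes branch: "regular_branch \<beta>"
begin

text \<open>
  Taking real parts, \<open>cosh (Im \<beta>) \<ge> cos (Re \<beta>) cosh (Im \<beta>) = 1 + sin\<^sup>2 (\<phi>/2)\<close>. The slope \<open>1/2\<close> near
  \<open>\<phi> = 0\<close> is what matches the hypothesis \<open>e^(\<pi>(j - 1)) / 2 > q\<^sup>2\<close>: with \<open>n + 3 = 2 q\<close> and
  \<open>\<phi> \<ge> (2 j - 1) \<pi> / (n + 3)\<close> it gives \<open>(n + 3) Im \<beta> \<ge> \<pi> (j - 1)\<close>. Away from \<open>0\<close> any positive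
  constant is enough.
\<close>

lemma Im_branch_ge:
  assumes \<phi>: "\<phi> \<in> {0<..<pi}"
  shows "Im (\<beta> \<phi>) \<ge> min (\<phi> / 2) (1 / 2)"
proof -
  define t where "t = min (\<phi> / 2) (1 / 2)"
  have t: "0 \<le> t" "t \<le> 1 / 2" "t \<le> \<phi> / 2"
    using \<phi> by (auto simp: t_def)
  have "sin t \<le> sin (\<phi> / 2)"
    using t \<phi> by (subst sin_mono_le_eq) auto
  then have sin_t: "(sin t)\<^sup>2 \<le> (sin (\<phi> / 2))\<^sup>2"
    using t pi_gt3 by (intro power_mono sin_ge_zero) auto
  have "cosh t \<le> 1 + (sin t)\<^sup>2"
    using t by (intro cosh_le_one_plus_sin_square)
  also have "\<dots> \<le> 1 + (sin (\<phi> / 2))\<^sup>2"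
    using sin_t by simp
  also have "\<dots> = Re (cos (\<beta> \<phi>))"
    unfolding cos_branch[OF branch \<phi>] by (simp add: cis_120 flip: of_real_power)
  also have "\<dots> = cos (Re (\<beta> \<phi>)) * cosh (Im (\<beta> \<phi>))"
    by (simp add: Re_cos cosh_field_def)
  also have "\<dots> \<le> cosh (Im (\<beta> \<phi>))"
    using mult_right_mono[OF cos_le_one, of "cosh (Im (\<beta> \<phi>))"] by (simp add: cosh_real_nonneg)
  finally have "t \<le> Im (\<beta> \<phi>)"
    using t Im_branch_pos[OF branch \<phi>] by (subst (asm) cosh_real_nonneg_le_iff) auto
  then show ?thesis
    by (simp add: t_def)
qed

text \<open>
  The exponential \<open>exp (i \<beta>) = cos \<beta> + i sin \<beta>\<close> is explicit, so its derivative is available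
  without differentiating a branch of \<open>arccos\<close>. The factor in front of it is \<open>i \<beta>'\<close>, where
  \<open>\<beta>' = e^(2\<pi>i/3) sin \<phi> / sin \<beta>\<close>.
\<close>

lemma exp_branch_has_vector_derivative:
  assumes \<phi>: "\<phi> \<in> {0<..<pi}"
  shows "((\<lambda>\<phi>. exp (\<i> * \<beta> \<phi>)) has_vector_derivative
     \<i> * (2 * cis (pi / 3) * of_real (cos (\<phi> / 2)) / sin_quot \<phi>) * exp (\<i> * \<beta> \<phi>)) (at \<phi>)"
proof -
  define E where "E = (\<lambda>\<phi>. 1 - 2 * (complex_of_real (sin (\<phi> / 2)))\<^sup>2 * cis (2 * pi / 3) +
      \<i> * (cis (pi / 3) * of_real (sin (\<phi> / 2)) * sin_quot \<phi>))"
  have E: "exp (\<i> * \<beta> x) = E x" if "x \<in> {0<..<pi}" for x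
    unfolding E_def exp_Euler cos_branch[OF branch that] sin_branch[OF branch that] by simp
  define u where "u = cis (pi / 3)"
  have u: "cis (2 * pi / 3) = u\<^sup>2"
    by (simp add: u_def cis_60_square)
  define s k R where "s = complex_of_real (sin (\<phi> / 2))" and "k = complex_of_real (cos (\<phi> / 2))"
    and "R = sin_quot \<phi>"
  have R: "R \<noteq> 0" "R\<^sup>2 = 4 - 4 * s\<^sup>2 * u\<^sup>2"
    unfolding R_def sin_quot_square s_def u
    using arg_cong[OF half_angle_identities(2)[of \<phi>], of complex_of_real] by simp_all
  have ds: "((\<lambda>x. complex_of_real (sin (x / 2))) has_vector_derivative k / 2) (at \<phi>)"
  proof -
    have "((\<lambda>x. sin (x / 2)) has_real_derivative cos (\<phi> / 2) / 2) (at \<phi>)"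
      by (auto intro!: derivative_eq_intros)
    from has_vector_derivative_of_real[OF this, where 'a = complex] show ?thesis
      by (simp add: k_def)
  qed
  have dR: "(sin_quot has_vector_derivative - u\<^sup>2 * (2 * s * k) / R) (at \<phi>)"
    using sin_quot_has_vector_derivative[of \<phi>]
    unfolding u half_angle_identities(1)[of \<phi>] by (simp add: s_def k_def R_def)
  have "(E has_vector_derivative - 2 * s * k * u\<^sup>2 + \<i> * (u * (k / 2 * R + s * (- u\<^sup>2 * (2 * s * k) / R)))) (at \<phi>)"
    unfolding E_def u u_def[symmetric] power2_eq_square[of "complex_of_real _"]
    by (rule derivative_eq_intros ds dR refl)+ (simp add: s_def[symmetric] R_def[symmetric] algebra_simps)
  also have "- 2 * s * k * u\<^sup>2 + \<i> * (u * (k / 2 * R + s * (- u\<^sup>2 * (2 * s * k) / R))) =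
      \<i> * (2 * u * k / R) * (1 - 2 * s\<^sup>2 * u\<^sup>2 + \<i> * (u * s * R))"
  proof -
    have "(- 2 * s * k * u\<^sup>2 + \<i> * (u * (k / 2 * R + s * (- u\<^sup>2 * (2 * s * k) / R)))) * R =
      - 2 * s * k * u\<^sup>2 * R + \<i> * u * (k / 2 * R\<^sup>2 - 2 * s\<^sup>2 * u\<^sup>2 * k)"
      using R(1) by (simp add: field_simps power2_eq_square)
    also have "\<dots> = \<i> * (2 * u * k) * (1 - 2 * s\<^sup>2 * u\<^sup>2 + \<i> * (u * s * R))"
      unfolding R(2) by (simp add: algebra_simps power2_eq_square)
    finally show ?thesis
      using R(1) by (simp add: field_simps)
  qed
  also have "1 - 2 * s\<^sup>2 * u\<^sup>2 + \<i> * (u * s * R) = exp (\<i> * \<beta> \<phi>)"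
    unfolding E[OF \<phi>] by (simp add: E_def u s_def R_def u_def)
  finally show ?thesis
    unfolding u_def k_def R_def
    by (rule has_vector_derivative_transform_within_open[where S = "{0<..<pi}"])
      (use \<phi> E in auto)
qed

end

section \<open>The right-hand sides of the equations as perturbed phases\<close>

text \<open>
  For \<open>\<sigma> = 1\<close> and \<open>\<sigma> = -1\<close> the left-hand side is \<open>-i tan (w/2)\<close> and \<open>i cot (w/2)\<close> at \<open>w = u + iv\<close>.
\<close>

lemma mobius_exp_eq:
  fixes \<sigma> u v :: real
  assumes \<sigma>: "\<sigma>\<^sup>2 = 1" and v: "v > 0"
  shows "(1 - of_real \<sigma> * exp (\<i> * Complex u v)) / (1 + of_real \<sigma> * exp (\<i> * Complex u v)) =
           Complex (sinh v) (- \<sigma> * sin u) / of_real (cosh v + \<sigma> * cos u)"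
proof -
  define z where "z = exp (\<i> * Complex u v)"
  define p q where "p = exp v" and "q = exp (- v)"
  have z: "Re z = q * cos u" "Im z = q * sin u"
    by (simp_all add: z_def q_def Re_exp Im_exp)
  have pq: "p * q = 1"
    by (simp add: p_def q_def flip: exp_add)
  have \<sigma>_abs: "\<bar>\<sigma>\<bar> = 1"
    using \<sigma> by (simp add: power2_eq_1_iff) auto
  have "norm z < 1"
    using v by (simp add: z_def)
  then have "norm (of_real \<sigma> * z) < 1"
    by (simp add: norm_mult \<sigma>_abs)
  then have nz: "1 + of_real \<sigma> * z \<noteq> 0"
    by (metis add_eq_0_iff2 less_irrefl norm_minus_cancel norm_one)
  have "\<bar>\<sigma> * cos u\<bar> \<le> 1"
    by (simp add: abs_mult \<sigma>_abs)
  moreover have "cosh v > 1"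
    using v cosh_real_strict_mono[of 0 v] by simp
  ultimately have den: "cosh v + \<sigma> * cos u \<noteq> 0"
    by linarith
  have "(1 - of_real \<sigma> * z) * of_real (cosh v + \<sigma> * cos u) =
      Complex (sinh v) (- \<sigma> * sin u) * (1 + of_real \<sigma> * z)"
  proof (rule complex_eqI)
    have cosh: "cosh v = (p + q) / 2" and sinh: "sinh v = (p - q) / 2"
      by (simp_all add: cosh_field_def sinh_field_def p_def q_def)
    show "Re ((1 - of_real \<sigma> * z) * of_real (cosh v + \<sigma> * cos u)) =
        Re (Complex (sinh v) (- \<sigma> * sin u) * (1 + of_real \<sigma> * z))"
    proof -
      have "(1 - \<sigma> * (q * cos u)) * ((p + q) / 2 + \<sigma> * cos u) =
          (p - q) / 2 * (1 + \<sigma> * (q * cos u)) + \<sigma> * sin u * (\<sigma> * (q * sin u))"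
        using pq \<sigma> sin_cos_squared_add[of u] by algebra
      then show ?thesis
        by (simp add: z cosh sinh)
    qed
    show "Im ((1 - of_real \<sigma> * z) * of_real (cosh v + \<sigma> * cos u)) =
        Im (Complex (sinh v) (- \<sigma> * sin u) * (1 + of_real \<sigma> * z))"
    proof -
      have "- (\<sigma> * (q * sin u)) * ((p + q) / 2 + \<sigma> * cos u) =
          (p - q) / 2 * (\<sigma> * (q * sin u)) - \<sigma> * sin u * (1 + \<sigma> * (q * cos u))"
        using pq \<sigma> by algebra
      then show ?thesis
        by (simp add: z cosh sinh)
    qed
  qed
  then show ?thesis
    unfolding z_def[symmetric] using nz den
    by (simp add: frac_eq_eq mult.commute del: of_real_add of_real_mult)
qed

text \<open>
  This is \<open>f \<phi> cos (\<phi>/2)\<close> for \<open>\<sigma> = 1\<close> and \<open>- h \<phi> cos (\<phi>/2)\<close> for \<open>\<sigma> = -1\<close>. The form as a rational function of the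
  small quantity \<open>exp (i (n + 3) \<beta> \<phi>)\<close> exhibits the limit \<open>Re (i sin_quot \<phi>) = 2 C \<phi> cos (\<phi>/2) / sin \<phi>\<close>, and it is
  free of the singularity of \<open>f\<close> and \<open>h\<close> at \<open>\<pi>\<close>.
\<close>

definition phase_height :: "(real \<Rightarrow> complex) \<Rightarrow> nat \<Rightarrow> real \<Rightarrow> real \<Rightarrow> real" where
  "phase_height \<beta> n \<sigma> \<phi> =
     Re (\<i> * (sin_quot \<phi> * ((1 - of_real \<sigma> * exp (\<i> * \<beta> \<phi>) ^ (n + 3)) /
                             (1 + of_real \<sigma> * exp (\<i> * \<beta> \<phi>) ^ (n + 3)))))"

lemma phase_height_eq:
  assumes branch: "regular_branch \<beta>" and \<phi>: "\<phi> \<in> {0<..<pi}" and \<sigma>: "\<sigma>\<^sup>2 = 1"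
  shows "phase_height \<beta> n \<sigma> \<phi> / cos (\<phi> / 2) =
    2 * ((\<sigma> * B_fun \<beta> \<phi> * sin (real (n + 3) * c_fun \<beta> \<phi>) + C_fun \<beta> \<phi> * sinh (real (n + 3) * b_fun \<beta> \<phi>)) /
         (sin \<phi> * (\<sigma> * cos (real (n + 3) * c_fun \<beta> \<phi>) + cosh (real (n + 3) * b_fun \<beta> \<phi>))))"
proof -
  define u v where "u = real (n + 3) * c_fun \<beta> \<phi>" and "v = real (n + 3) * b_fun \<beta> \<phi>"
  have v: "v > 0"
    using Im_branch_pos[OF branch \<phi>] by (simp add: v_def b_fun_def)
  have "exp (\<i> * \<beta> \<phi>) ^ (n + 3) = exp (of_nat (n + 3) * (\<i> * \<beta> \<phi>))"
    by (rule exp_of_nat_mult[symmetric])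
  also have "of_nat (n + 3) * (\<i> * \<beta> \<phi>) = \<i> * Complex u v"
    by (simp add: complex_eq_iff u_def v_def c_fun_def b_fun_def)
  finally have "phase_height \<beta> n \<sigma> \<phi> =
      Re (\<i> * (sin_quot \<phi> * (Complex (sinh v) (- \<sigma> * sin u) / of_real (cosh v + \<sigma> * cos u))))"
    unfolding phase_height_def by (simp only: mobius_exp_eq[OF \<sigma> v])
  also have "\<dots> = Re (\<i> * (sin_quot \<phi> * Complex (sinh v) (- \<sigma> * sin u)) / of_real (cosh v + \<sigma> * cos u))"
    by (simp only: times_divide_eq_right)
  also have "\<dots> = (\<sigma> * Re (sin_quot \<phi>) * sin u - Im (sin_quot \<phi>) * sinh v) / (cosh v + \<sigma> * cos u)"
    unfolding Re_divide_of_real by (simp add: algebra_simps)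
  finally have height: "phase_height \<beta> n \<sigma> \<phi> =
      (\<sigma> * Re (sin_quot \<phi>) * sin u - Im (sin_quot \<phi>) * sinh v) / (cosh v + \<sigma> * cos u)" .
  show ?thesis
    unfolding height B_fun_eq[OF branch \<phi>] C_fun_eq[OF branch \<phi>] u_def[symmetric] v_def[symmetric]
      half_angle_identities(1)[of \<phi>]
    using half_angle_pos[OF \<phi>] by (simp add: divide_simps) (simp add: algebra_simps)
qed

text \<open>
  Both bounds come from \<open>(1 - \<sigma> z) / (1 + \<sigma> z) - 1 = -2 \<sigma> z / (1 + \<sigma> z)\<close>. For the slope,
  \<open>\<bar>z'\<bar> \<le> (n + 3) \<bar>z\<bar>\<close> because \<open>\<bar>\<beta>'\<bar> \<le> 1\<close>, so the hypothesis that \<open>z\<close> is of order \<open>1/(n + 3)\<^sup>2\<close>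
  absorbs the factor \<open>n + 3\<close>.
\<close>

lemma phase_height_bounds:
  assumes branch: "regular_branch \<beta>" and \<phi>: "\<phi> \<in> {0<..<pi}" and \<sigma>: "\<sigma>\<^sup>2 = 1"
    and small: "norm (exp (\<i> * \<beta> \<phi>) ^ (n + 3)) \<le> 2 / (real (n + 3))\<^sup>2" and n: "n \<ge> 1"
  shows phase_height_near_limit: "\<bar>phase_height \<beta> n \<sigma> \<phi> + Im (sin_quot \<phi>)\<bar> \<le> 24 / (real (n + 3))\<^sup>2"
    and phase_height_slope: "\<exists>Y'. (phase_height \<beta> n \<sigma> has_real_derivative Y') (at \<phi>) \<and> \<bar>Y'\<bar> \<le> 14"
proof -
  define N where "N = real (n + 3)"
  have N: "N \<ge> 4"
    using n by (simp add: N_def)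
  define Z where "Z = (\<lambda>\<phi>. exp (\<i> * \<beta> \<phi>) ^ (n + 3))"
  define q where "q = (\<lambda>\<phi>. (1 - of_real \<sigma> * Z \<phi>) / (1 + of_real \<sigma> * Z \<phi>))"
  have height: "phase_height \<beta> n \<sigma> = (\<lambda>\<phi>. Re (\<i> * (sin_quot \<phi> * q \<phi>)))"
    by (simp add: fun_eq_iff phase_height_def q_def Z_def)
  have \<sigma>_norm: "norm (complex_of_real \<sigma>) = 1"
    using \<sigma> by (auto simp: power2_eq_1_iff)
  then have \<sigma>_abs: "\<bar>\<sigma>\<bar> = 1"
    by simp
  have Z_small: "norm (Z \<phi>) \<le> 2 / N\<^sup>2"
    using small by (simp add: Z_def N_def)
  have "4\<^sup>2 \<le> N\<^sup>2"
    using N by (intro power_mono) auto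
  then have "2 / N\<^sup>2 \<le> 1 / 8"
    using N by (simp add: divide_le_eq)
  then have Z_half: "norm (of_real \<sigma> * Z \<phi>) \<le> 1 / 2"
    using Z_small by (simp add: norm_mult \<sigma>_abs)
  have den: "norm (1 + of_real \<sigma> * Z \<phi>) \<ge> 1 / 2"
    using norm_triangle_ineq2[of 1 "- (of_real \<sigma> * Z \<phi>)"] Z_half by simp
  then have den_nz: "1 + of_real \<sigma> * Z \<phi> \<noteq> 0"
    by (metis norm_zero not_one_le_zero zero_less_divide_1_iff zero_less_numeral not_less)
  have inv_den: "norm (inverse (1 + of_real \<sigma> * Z \<phi>)) \<le> 2"
    using le_imp_inverse_le[OF den] by (simp add: norm_inverse)

  have "q \<phi> - 1 = - 2 * (of_real \<sigma> * Z \<phi>) * inverse (1 + of_real \<sigma> * Z \<phi>)"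
    using den_nz by (simp add: q_def field_simps)
  then have "norm (q \<phi> - 1) = 2 * norm (Z \<phi>) * norm (inverse (1 + of_real \<sigma> * Z \<phi>))"
    by (simp add: norm_mult \<sigma>_abs)
  also have "\<dots> \<le> 2 * (2 / N\<^sup>2) * 2"
    using Z_small inv_den by (intro mult_mono) auto
  finally have q_near: "norm (q \<phi> - 1) \<le> 8 / N\<^sup>2"
    by simp
  have "phase_height \<beta> n \<sigma> \<phi> + Im (sin_quot \<phi>) = Re (\<i> * (sin_quot \<phi> * (q \<phi> - 1)))"
    by (simp add: height algebra_simps)
  also have "\<bar>\<dots>\<bar> \<le> norm (\<i> * (sin_quot \<phi> * (q \<phi> - 1)))"
    by (rule abs_Re_le_cmod)
  also have "\<dots> \<le> 3 * (8 / N\<^sup>2)"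
    unfolding norm_mult norm_ii mult_1
    using q_near norm_sin_quot_le[of \<phi>] by (intro mult_mono) auto
  finally show "\<bar>phase_height \<beta> n \<sigma> \<phi> + Im (sin_quot \<phi>)\<bar> \<le> 24 / (real (n + 3))\<^sup>2"
    by (simp add: N_def)

  \<comment> \<open>logarithmic derivative of \<open>exp (i \<beta>)\<close>\<close>
  define \<delta> where "\<delta> = \<i> * (2 * cis (pi / 3) * of_real (cos (\<phi> / 2)) / sin_quot \<phi>)"
  have "norm \<delta> = 2 * \<bar>cos (\<phi> / 2)\<bar> / norm (sin_quot \<phi>)"
    by (simp add: \<delta>_def norm_mult norm_divide)
  also have "\<dots> \<le> 2 * 1 / 2"
    using norm_sin_quot_ge[of \<phi>] by (intro frac_le) auto
  finally have \<delta>: "norm \<delta> \<le> 1"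
    by simp
  have dZ: "(Z has_vector_derivative of_nat (n + 3) * \<delta> * Z \<phi>) (at \<phi>)"
  proof -
    have "((\<lambda>w. w ^ (n + 3)) has_field_derivative of_nat (n + 3) * exp (\<i> * \<beta> \<phi>) ^ (n + 2)) (at (exp (\<i> * \<beta> \<phi>)))"
      using DERIV_power[OF DERIV_ident, of "n + 3" "exp (\<i> * \<beta> \<phi>)" UNIV] by (simp add: eval_nat_numeral)
    from field_vector_diff_chain_at[OF exp_branch_has_vector_derivative[OF branch \<phi>] this]
    show ?thesis
      by (simp add: o_def Z_def \<delta>_def mult_ac eval_nat_numeral)
  qed
  define q' where "q' = - 2 * (of_real \<sigma> * (of_nat (n + 3) * \<delta> * Z \<phi>)) * (inverse (1 + of_real \<sigma> * Z \<phi>))\<^sup>2"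
  have dq: "(q has_vector_derivative q') (at \<phi>)"
  proof -
    have outer: "((\<lambda>w. (1 - of_real \<sigma> * w) / (1 + of_real \<sigma> * w)) has_field_derivative
        - 2 * of_real \<sigma> * (inverse (1 + of_real \<sigma> * Z \<phi>))\<^sup>2) (at (Z \<phi>))"
      using den_nz by (auto intro!: derivative_eq_intros simp: field_simps power2_eq_square)
    have "of_nat (n + 3) * \<delta> * Z \<phi> * (- 2 * of_real \<sigma> * (inverse (1 + of_real \<sigma> * Z \<phi>))\<^sup>2) = q'"
      unfolding q'_def by algebra
    then show ?thesis
      using field_vector_diff_chain_at[OF dZ outer] by (simp only: o_def q_def)
  qed
  have "norm q' = 2 * (N * norm \<delta> * norm (Z \<phi>)) * (norm (inverse (1 + of_real \<sigma> * Z \<phi>)))\<^sup>2"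
    unfolding q'_def norm_mult norm_power \<sigma>_norm N_def by (simp del: of_nat_add)
  also have "\<dots> \<le> 2 * (N * 1 * (2 / N\<^sup>2)) * 2\<^sup>2"
    using \<delta> Z_small inv_den N by (intro mult_mono power_mono) auto
  also have "\<dots> = 16 / N"
    using N by (simp add: power2_eq_square)
  also have "\<dots> \<le> 4"
    using N by (simp add: field_simps)
  finally have q': "norm q' \<le> 4" .
  have "norm (1 - of_real \<sigma> * Z \<phi>) \<le> 3 / 2"
    using norm_triangle_ineq4[of 1 "of_real \<sigma> * Z \<phi>"] Z_half by simp
  then have q: "norm (q \<phi>) \<le> 3 / 2 * 2"
    unfolding q_def divide_inverse norm_mult using inv_den by (intro mult_mono) auto
  define R' where "R' = - cis (2 * pi / 3) * of_real (sin \<phi>) / sin_quot \<phi>"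
  have "norm R' = \<bar>sin \<phi>\<bar> / norm (sin_quot \<phi>)"
    by (simp add: R'_def norm_mult norm_divide)
  also have "\<dots> \<le> 1 / 2"
    using norm_sin_quot_ge[of \<phi>] by (intro frac_le) auto
  finally have R': "norm R' \<le> 1 / 2" .
  define Y' where "Y' = Re (\<i> * (sin_quot \<phi> * q' + R' * q \<phi>))"
  have "((\<lambda>\<phi>. \<i> * (sin_quot \<phi> * q \<phi>)) has_vector_derivative \<i> * (sin_quot \<phi> * q' + R' * q \<phi>)) (at \<phi>)"
    using has_vector_derivative_mult[OF sin_quot_has_vector_derivative[of \<phi>] dq]
    unfolding R'_def by (rule has_vector_derivative_mult_right)
  then have "(phase_height \<beta> n \<sigma> has_real_derivative Y') (at \<phi>)"
    unfolding height Y'_def has_real_derivative_iff_has_vector_derivative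
    by (rule bounded_linear.has_vector_derivative[OF bounded_linear_Re])
  moreover have "\<bar>Y'\<bar> \<le> 14"
  proof -
    have "\<bar>Y'\<bar> \<le> norm (sin_quot \<phi> * q' + R' * q \<phi>)"
      unfolding Y'_def using abs_Re_le_cmod[of "\<i> * (sin_quot \<phi> * q' + R' * q \<phi>)"] by (simp add: norm_mult)
    also have "\<dots> \<le> norm (sin_quot \<phi>) * norm q' + norm R' * norm (q \<phi>)"
      by (metis norm_mult norm_triangle_ineq)
    also have "\<dots> \<le> 3 * 4 + 1 / 2 * (3 / 2 * 2)"
      using norm_sin_quot_le[of \<phi>] q' R' q by (intro add_mono mult_mono) auto
    finally show ?thesis
      by simp
  qed
  ultimately show "\<exists>Y'. (phase_height \<beta> n \<sigma> has_real_derivative Y') (at \<phi>) \<and> \<bar>Y'\<bar> \<le> 14"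
    by blast
qed

section \<open>The limit phase and the coefficients of the expansion\<close>

text \<open>
  The phase \<open>arctan (2 C \<phi> / sin \<phi>)\<close> left after dropping the exponentially small terms, with the
  common factor \<open>sin (\<phi>/2)\<close> of \<open>C \<phi>\<close> and \<open>sin \<phi>\<close> cancelled.
\<close>

definition limit_phase :: "real \<Rightarrow> real" where
  "limit_phase \<phi> = arctan (- Im (sin_quot \<phi>) / cos (\<phi> / 2))"

text \<open>
  With \<open>s = sin (\<phi>/2)\<close> and \<open>R = sin_quot \<phi>\<close>, the imaginary part of \<open>R\<^sup>2\<close> gives
  \<open>- Im R = \<surd>3 s\<^sup>2 / Re R \<ge> s\<^sup>2 / 2\<close>, while \<open>cos (\<phi>/2) \<ge> 1 - s\<^sup>2\<close>. So the vector whose argument is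
  the limit phase stays away from \<open>0\<close>, uniformly up to the end point \<open>\<pi>\<close>.
\<close>

lemma half_le_cos_minus_Im_sin_quot:
  assumes \<phi>: "\<phi> \<in> {0<..<pi}"
  shows "cos (\<phi> / 2) - Im (sin_quot \<phi>) \<ge> 1 / 2"
proof -
  define s k P D where "s = sin (\<phi> / 2)" and "k = cos (\<phi> / 2)"
    and "P = Re (sin_quot \<phi>)" and "D = - Im (sin_quot \<phi>)"
  have P: "P \<ge> 2" "P \<le> 3"
    using Re_sin_quot_ge[of \<phi>] norm_sin_quot_le[of \<phi>] complex_Re_le_cmod[of "sin_quot \<phi>"]
    by (simp_all add: P_def)
  have "2 * P * (- D) = - sqrt 3 * (2 * s\<^sup>2)"
    unfolding P_def D_def s_def half_angle_identities(2)[of \<phi>, symmetric] minus_minus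
    by (rule Im_sin_quot_square)
  then have PD: "P * D = sqrt 3 * s\<^sup>2"
    by simp
  then have "P * D \<ge> 0"
    by simp
  then have D: "D \<ge> 0"
    using P by (simp add: zero_le_mult_iff)
  have "sqrt 3 \<le> (2::real)"
    by (rule real_le_lsqrt) auto
  have "3 * s\<^sup>2 = sqrt 3 * (P * D)"
    unfolding PD by simp
  also have "\<dots> \<le> 2 * (3 * D)"
    using P D \<open>sqrt 3 \<le> 2\<close> by (intro mult_mono) auto
  finally have "s\<^sup>2 / 2 \<le> D"
    by simp
  have "k \<ge> 0" "k \<le> 1"
    using half_angle_pos[OF \<phi>] by (auto simp: k_def)
  then have "k\<^sup>2 \<le> k"
    by (simp add: power2_eq_square mult_left_le)
  moreover have "s\<^sup>2 + k\<^sup>2 = 1"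
    by (simp add: s_def k_def)
  ultimately have "k + D \<ge> 1 / 2"
    using \<open>s\<^sup>2 / 2 \<le> D\<close> zero_le_power2[of k] by linarith
  then show ?thesis
    by (simp add: k_def D_def)
qed

text \<open>
  The numerator and denominator of the limit phase have bounded derivatives up to order two, since
  \<open>\<bar>sin_quot\<bar> \<ge> 2\<close>. One constant therefore serves the whole interval; this is the source of the
  uniformity in \<open>j\<close>.
\<close>

lemma limit_phase_Taylor:
  obtains M where "\<And>d. d \<in> {0<..<pi} \<Longrightarrow> \<exists>\<eta>'. (limit_phase has_real_derivative \<eta>') (at d) \<and> \<bar>\<eta>'\<bar> \<le> M \<and>
    (\<forall>x\<in>{0<..<pi}. \<bar>limit_phase x - limit_phase d - \<eta>' * (x - d)\<bar> \<le> M * (x - d)\<^sup>2)"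
proof -
  define w where "w = cis (2 * pi / 3)"
  have w: "norm w = 1"
    by (simp add: w_def)
  define y y' y'' where "y = (\<lambda>x. - Im (sin_quot x))"
    and "y' = (\<lambda>x. Im (w * (of_real (sin x) * inverse (sin_quot x))))"
    and "y'' = (\<lambda>x. Im (w * (of_real (sin x) * (w * of_real (sin x) * inverse (sin_quot x) ^ 3) +
                           of_real (cos x) * inverse (sin_quot x))))"
  have dR: "(sin_quot has_vector_derivative - (w * (of_real (sin x) * inverse (sin_quot x)))) (at x)" for x
  proof -
    have "- cis (2 * pi / 3) * of_real (sin x) / sin_quot x = - (w * (of_real (sin x) * inverse (sin_quot x)))"
      by (simp add: w_def field_simps)
    then show ?thesis
      using sin_quot_has_vector_derivative[of x] by (simp only:)
  qed
  have dy: "(y has_real_derivative y' x) (at x)" for x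
    using bounded_linear.has_vector_derivative[OF bounded_linear_Im has_vector_derivative_minus[OF dR[of x]]]
    unfolding has_real_derivative_iff_has_vector_derivative y_def y'_def by simp
  have dy': "(y' has_real_derivative y'' x) (at x)" for x
  proof -
    have dinv: "((\<lambda>x. inverse (sin_quot x)) has_vector_derivative
        w * of_real (sin x) * inverse (sin_quot x) ^ 3) (at x)"
    proof -
      have "(inverse has_field_derivative - (inverse (sin_quot x) ^ 2)) (at (sin_quot x))"
        using DERIV_inverse[of "sin_quot x" UNIV] by (simp add: numeral_2_eq_2)
      from field_vector_diff_chain_at[OF dR this] show ?thesis
        by (simp add: o_def power2_eq_square power3_eq_cube mult.assoc)
    qed
    have dsin: "((\<lambda>x. complex_of_real (sin x)) has_vector_derivative of_real (cos x)) (at x)"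
      by (rule has_vector_derivative_of_real[OF DERIV_sin])
    show ?thesis
      using bounded_linear.has_vector_derivative[OF bounded_linear_Im
          has_vector_derivative_mult_right[OF has_vector_derivative_mult[OF dsin dinv], of w]]
      unfolding has_real_derivative_iff_has_vector_derivative y'_def y''_def .
  qed
  have inv_quot: "norm (inverse (sin_quot x)) \<le> 1 / 2" for x
    using le_imp_inverse_le[OF norm_sin_quot_ge[of x]] by (simp add: norm_inverse)
  have y_le: "\<bar>y x\<bar> \<le> 3" for x
    unfolding y_def using abs_Im_le_cmod[of "sin_quot x"] norm_sin_quot_le[of x] by simp
  have y'_le: "\<bar>y' x\<bar> \<le> 3" for x
  proof -
    have "\<bar>y' x\<bar> \<le> norm (w * (of_real (sin x) * inverse (sin_quot x)))"
      unfolding y'_def by (rule abs_Im_le_cmod)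
    also have "\<dots> \<le> 1 * (1 * (1 / 2))"
      unfolding norm_mult w using inv_quot by (intro mult_mono) auto
    finally show ?thesis
      by simp
  qed
  have y''_le: "\<bar>y'' x\<bar> \<le> 3" for x
  proof -
    have "\<bar>y'' x\<bar> \<le> norm (w * (of_real (sin x) * (w * of_real (sin x) * inverse (sin_quot x) ^ 3) +
                           of_real (cos x) * inverse (sin_quot x)))"
      unfolding y''_def by (rule abs_Im_le_cmod)
    also have "\<dots> \<le> norm (complex_of_real (sin x) * (w * of_real (sin x) * inverse (sin_quot x) ^ 3)) +
        norm (complex_of_real (cos x) * inverse (sin_quot x))"
      unfolding norm_mult[of w] w using norm_triangle_ineq by simp
    also have "\<dots> \<le> 1 * (1 * 1 * (1 / 2) ^ 3) + 1 * (1 / 2)"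
      unfolding norm_mult norm_power w using inv_quot
      by (intro add_mono mult_mono power_mono) auto
    finally show ?thesis
      by (simp add: power3_eq_cube)
  qed
  have dk: "((\<lambda>x. cos (x / 2)) has_real_derivative - sin (x / 2) / 2) (at x)" for x :: real
    by (auto intro!: derivative_eq_intros)
  have dk': "((\<lambda>x. - sin (x / 2) / 2) has_real_derivative - cos (x / 2) / 4) (at x)" for x :: real
    by (auto intro!: derivative_eq_intros)
  have away: "(cos (x / 2))\<^sup>2 + (y x)\<^sup>2 \<ge> 1 / 8" if "x \<in> {0<..<pi}" for x
  proof -
    have "(1 / 2)\<^sup>2 \<le> (cos (x / 2) + y x)\<^sup>2"
      using half_le_cos_minus_Im_sin_quot[OF that] by (intro power_mono) (auto simp: y_def)
    also have "\<dots> \<le> (cos (x / 2) + y x)\<^sup>2 + (cos (x / 2) - y x)\<^sup>2"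
      by simp
    also have "\<dots> = 2 * ((cos (x / 2))\<^sup>2 + (y x)\<^sup>2)"
      by (simp add: power2_eq_square algebra_simps)
    finally show ?thesis
      by (simp add: power_one_over)
  qed
  have trig_le: "\<bar>cos (x / 2)\<bar> \<le> 3 \<and> \<bar>- sin (x / 2) / 2\<bar> \<le> 3 \<and> \<bar>- cos (x / 2) / 4\<bar> \<le> 3" for x :: real
    using abs_cos_le_one[of "x / 2"] abs_sin_le_one[of "x / 2"] by linarith
  show thesis
  proof (rule arctan_quotient_Taylor[of 0 pi "\<lambda>x. cos (x / 2)" "\<lambda>x. - sin (x / 2) / 2" "\<lambda>x. - cos (x / 2) / 4" y y' y'' "1 / 8" 3])
    fix M
    let ?\<eta>' = "\<lambda>x. (y' x * cos (x / 2) - y x * (- sin (x / 2) / 2)) / ((cos (x / 2))\<^sup>2 + (y x)\<^sup>2)"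
    assume 1: "\<And>d. d \<in> {0<..<pi} \<Longrightarrow> ((\<lambda>x. arctan (y x / cos (x / 2))) has_real_derivative ?\<eta>' d) (at d)"
      and 2: "\<And>d. d \<in> {0<..<pi} \<Longrightarrow> \<bar>?\<eta>' d\<bar> \<le> M"
      and 3: "\<And>d x. d \<in> {0<..<pi} \<Longrightarrow> x \<in> {0<..<pi} \<Longrightarrow>
       \<bar>arctan (y x / cos (x / 2)) - arctan (y d / cos (d / 2)) - ?\<eta>' d * (x - d)\<bar> \<le> M * (x - d)\<^sup>2"
    have eq: "limit_phase = (\<lambda>x. arctan (y x / cos (x / 2)))"
      by (simp add: fun_eq_iff limit_phase_def y_def)
    show thesis
    proof (rule that)
      fix d :: real
      assume d: "d \<in> {0<..<pi}"
      show "\<exists>\<eta>'. (limit_phase has_real_derivative \<eta>') (at d) \<and> \<bar>\<eta>'\<bar> \<le> M \<and>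
        (\<forall>x\<in>{0<..<pi}. \<bar>limit_phase x - limit_phase d - \<eta>' * (x - d)\<bar> \<le> M * (x - d)\<^sup>2)"
        unfolding eq using 1[OF d] 2[OF d] 3[OF d] by (intro exI[of _ "?\<eta>' d"]) blast
    qed
  next
    show "0 < cos (x / 2)" if "x \<in> {0<..<pi}" for x :: real
      by (rule half_angle_pos(2)[OF that])
  next
    show "1 / 8 \<le> (cos (x / 2))\<^sup>2 + (y x)\<^sup>2" if "x \<in> {0<..<pi}" for x
      by (rule away[OF that])
  next
    show "\<bar>cos (x / 2)\<bar> \<le> 3 \<and> \<bar>- sin (x / 2) / 2\<bar> \<le> 3 \<and> \<bar>- cos (x / 2) / 4\<bar> \<le> 3" for x :: real
      by (rule trig_le)
  next
    show "\<bar>y x\<bar> \<le> 3 \<and> \<bar>y' x\<bar> \<le> 3 \<and> \<bar>y'' x\<bar> \<le> 3" for x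
      using y_le y'_le y''_le by blast
  qed (rule dk dk' dy dy' | simp)+
qed

context
  fixes \<beta> :: "real \<Rightarrow> complex"
  assumes branch: "regular_branch \<beta>"
begin

lemma coeff1_eq_limit_phase:
  assumes "d \<in> {0<..<pi}"
  shows "coeff1 \<beta> d = limit_phase d"
  unfolding coeff1_def limit_phase_def C_fun_eq[OF branch assms] half_angle_identities(1)[of d]
  using half_angle_pos[OF assms] by simp

text \<open>
  The factor of the arctangent in \<open>coeff2\<close> is the derivative of \<open>arctan (2 C / sin)\<close>, computed by the quotient rule.
\<close>

lemma coeff2_eq_limit_phase:
  assumes d: "d \<in> {0<..<pi}" and deriv: "(limit_phase has_real_derivative \<eta>') (at d)"
  shows "coeff2 \<beta> d = \<eta>' * limit_phase d"
proof -
  have "((\<lambda>x. - (sin (x / 2) * Im (sin_quot x))) has_real_derivative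
      - (cos (d / 2) / 2 * Im (sin_quot d) +
         Im (- cis (2 * pi / 3) * of_real (sin d) / sin_quot d) * sin (d / 2))) (at d)"
  proof (intro DERIV_minus DERIV_mult)
    show "((\<lambda>x. sin (x / 2)) has_real_derivative cos (d / 2) / 2) (at d)"
      by (auto intro!: derivative_eq_intros)
    show "((\<lambda>x. Im (sin_quot x)) has_real_derivative Im (- cis (2 * pi / 3) * of_real (sin d) / sin_quot d)) (at d)"
      unfolding has_real_derivative_iff_has_vector_derivative
      by (rule bounded_linear.has_vector_derivative[OF bounded_linear_Im sin_quot_has_vector_derivative])
  qed
  then obtain C' where "((\<lambda>x. - (sin (x / 2) * Im (sin_quot x))) has_real_derivative C') (at d)"
    by blast
  then have C': "(C_fun \<beta> has_real_derivative C') (at d)"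
    by (rule has_field_derivative_transform_within_open[where S = "{0<..<pi}"])
      (use d C_fun_eq[OF branch] in auto)
  define S where "S = (sin d)\<^sup>2 + 4 * (C_fun \<beta> d)\<^sup>2"
  have sin: "sin d > 0"
    using half_angle_pos[OF d] by simp
  have "((\<lambda>x. arctan (2 * (C_fun \<beta> x / sin x))) has_real_derivative
      inverse (1 + (2 * (C_fun \<beta> d / sin d))\<^sup>2) * (2 * ((C' * sin d - C_fun \<beta> d * cos d) / (sin d * sin d)))) (at d)"
    using sin by (intro DERIV_chain2[OF DERIV_arctan] DERIV_cmult DERIV_divide C' DERIV_sin) auto
  also have "inverse (1 + (2 * (C_fun \<beta> d / sin d))\<^sup>2) * (2 * ((C' * sin d - C_fun \<beta> d * cos d) / (sin d * sin d))) =
      2 * ((C' * sin d - C_fun \<beta> d * cos d) / S)"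
  proof -
    have "1 + (2 * (C_fun \<beta> d / sin d))\<^sup>2 = S / (sin d * sin d)"
      using sin by (simp add: S_def field_simps power2_eq_square)
    then show ?thesis
      using sin by simp
  qed
  finally have "(limit_phase has_real_derivative 2 * ((C' * sin d - C_fun \<beta> d * cos d) / S)) (at d)"
    by (rule has_field_derivative_transform_within_open[where S = "{0<..<pi}"])
      (use d coeff1_eq_limit_phase in \<open>auto simp: coeff1_def\<close>)
  then have "2 * ((C' * sin d - C_fun \<beta> d * cos d) / S) = \<eta>'"
    using deriv by (rule DERIV_unique)
  then show ?thesis
    unfolding coeff2_def DERIV_imp_deriv[OF C'] S_def[symmetric]
    using coeff1_eq_limit_phase[OF d] by (simp add: coeff1_def)
qed

section \<open>Location and expansion of a single root\<close>

text \<open>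
  Here \<open>J\<close> stands for \<open>\<pi> (j - 1)\<close>. For small \<open>\<phi>\<close> the bound is the hypothesis on \<open>j\<close>; elsewhere the
  left-hand side is at most \<open>exp (- (n + 3) / 2)\<close>.
\<close>

lemma exp_branch_power_small:
  fixes J :: real
  assumes \<phi>: "\<phi> \<in> {0<..<pi}" and n: "n \<ge> 105"
    and J: "J \<le> real (n + 3) * \<phi> / 2" "exp J / 2 > (real (n + 3) / 2)\<^sup>2"
  shows "norm (exp (\<i> * \<beta> \<phi>) ^ (n + 3)) \<le> 2 / (real (n + 3))\<^sup>2"
proof -
  define N where "N = real (n + 3)"
  have N: "N \<ge> 108"
    using n by (simp add: N_def)
  \<comment> \<open>the threshold \<open>108\<close> comes from \<open>(N / 6)\<^sup>3 = (N / 108) (N\<^sup>2 / 2)\<close>\<close>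
  have "N\<^sup>2 / 2 \<le> (N / 6) ^ 3"
    using mult_right_mono[of 108 N "N\<^sup>2"] N by (simp add: power2_eq_square power3_eq_cube)
  also have "\<dots> \<le> exp (N / 6) ^ 3"
  proof (rule power_mono)
    show "N / 6 \<le> exp (N / 6)"
      using exp_ge_add_one_self[of "N / 6"] by linarith
  qed (use N in simp)
  also have "\<dots> = exp (N / 2)"
    by (simp flip: exp_of_nat_mult)
  finally have "N\<^sup>2 / 2 \<le> exp (N / 2)" .
  moreover have "N\<^sup>2 / 2 \<le> exp (N * \<phi> / 2)"
  proof -
    have "N\<^sup>2 / 2 \<le> exp J"
      using J(2) unfolding N_def[symmetric] by (simp add: power_divide)
    also have "exp J \<le> exp (N * \<phi> / 2)"
      using J(1) by (simp add: N_def)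
    finally show ?thesis .
  qed
  ultimately have "N\<^sup>2 / 2 \<le> exp (min (N * \<phi> / 2) (N / 2))"
    by (simp add: min_def)
  also have "min (N * \<phi> / 2) (N / 2) \<le> N * Im (\<beta> \<phi>)"
    using mult_left_mono[OF Im_branch_ge[OF branch \<phi>], of N] N by (simp add: min_mult_distrib_left)
  finally have "N\<^sup>2 / 2 \<le> exp (N * Im (\<beta> \<phi>))"
    by simp
  then have "inverse (exp (N * Im (\<beta> \<phi>))) \<le> inverse (N\<^sup>2 / 2)"
    using N by (intro le_imp_inverse_le) auto
  moreover have "norm (exp (\<i> * \<beta> \<phi>) ^ (n + 3)) = inverse (exp (N * Im (\<beta> \<phi>)))"
    by (simp add: norm_power N_def flip: exp_minus exp_of_nat_mult)
  ultimately show ?thesis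
    by (simp add: N_def)
qed

text \<open>
  On the interval around \<open>d\<close> the exact phase differs from the limit phase by at most \<open>8 \<cdot> 24 / N\<^sup>2\<close>, and it is
  Lipschitz with constant \<open>8 (1/2 + 14) = 116\<close>; the factor \<open>8\<close> is the Lipschitz constant of
  \<open>arctan (y / k)\<close>. For \<open>n \<ge> 300\<close> the constant is below \<open>N / 2\<close>, so the root is unique.
\<close>

lemma perturbed_phase_equation:
  fixes d J \<sigma> :: real
  defines "\<theta> \<equiv> \<lambda>n x. arctan (phase_height \<beta> n \<sigma> x / cos (x / 2))"
  assumes n: "n \<ge> 300" and \<sigma>: "\<sigma>\<^sup>2 = 1"
    and I: "{d - pi / real (n + 3)..d + pi / real (n + 3)} \<subseteq> {0<..<pi}"
    and J: "J \<le> real (n + 3) * (d - pi / real (n + 3)) / 2" "exp J / 2 > (real (n + 3) / 2)\<^sup>2"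
  shows "\<exists>!x. x \<in> {d - pi / real (n + 3)<..<d + pi / real (n + 3)} \<and> x = d + 2 / real (n + 3) * \<theta> n x"
    and "\<And>x. x \<in> {d - pi / real (n + 3)..d + pi / real (n + 3)} \<Longrightarrow>
           \<bar>\<theta> n x - limit_phase x\<bar> \<le> 192 / (real (n + 3))\<^sup>2"
proof -
  define N where "N = real (n + 3)"
  have N: "N \<ge> 303"
    using n by (simp add: N_def)
  let ?I = "{d - pi / N..d + pi / N}"
  let ?H = "phase_height \<beta> n \<sigma>"
  have in_pi: "x \<in> {0<..<pi}" if "x \<in> ?I" for x
    using I that unfolding N_def by blast
  have small: "norm (exp (\<i> * \<beta> x) ^ (n + 3)) \<le> 2 / (real (n + 3))\<^sup>2" if x: "x \<in> ?I" for x
  proof (rule exp_branch_power_small[OF in_pi[OF x] _ _ J(2)])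
    have "N * (d - pi / N) \<le> N * x"
      using x N by (intro mult_left_mono) auto
    then have "N * (d - pi / N) / 2 \<le> N * x / 2"
      by simp
    then show "J \<le> real (n + 3) * x / 2"
      unfolding N_def by (rule order_trans[OF J(1)])
  qed (use n in simp)
  have near: "\<bar>?H x + Im (sin_quot x)\<bar> \<le> 24 / N\<^sup>2" if x: "x \<in> ?I" for x
    unfolding N_def using n by (intro phase_height_near_limit[OF branch in_pi[OF x] \<sigma> small[OF x]]) simp
  have "100 \<le> N\<^sup>2"
    using power_mono[of 10 N 2] N by simp
  then have "24 / N\<^sup>2 \<le> 1 / 4"
    using N by (simp add: divide_le_eq)
  have quarter: "cos (x / 2) + ?H x \<ge> 1 / 4" if x: "x \<in> ?I" for x
    using near[OF x] \<open>24 / N\<^sup>2 \<le> 1 / 4\<close> half_le_cos_minus_Im_sin_quot[OF in_pi[OF x]] by linarith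
  show "\<bar>\<theta> n x - limit_phase x\<bar> \<le> 192 / (real (n + 3))\<^sup>2"
    if "x \<in> {d - pi / real (n + 3)..d + pi / real (n + 3)}" for x
  proof -
    have x: "x \<in> ?I"
      using that by (simp add: N_def)
    have "\<bar>\<theta> n x - limit_phase x\<bar> \<le> 8 * (\<bar>cos (x / 2) - cos (x / 2)\<bar> + \<bar>?H x - (- Im (sin_quot x))\<bar>)"
      unfolding \<theta>_def limit_phase_def
      using half_angle_pos[OF in_pi[OF x]] quarter[OF x] half_le_cos_minus_Im_sin_quot[OF in_pi[OF x]]
      by (intro arctan_quotient_Lipschitz) auto
    then show ?thesis
      using near[OF x] by (simp add: N_def)
  qed
  have H_Lip: "\<bar>?H x - ?H y\<bar> \<le> 14 * \<bar>x - y\<bar>" if "x \<in> ?I" "y \<in> ?I" for x y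
  proof -
    have "\<forall>z\<in>?I. \<exists>Y'. (?H has_real_derivative Y') (at z) \<and> \<bar>Y'\<bar> \<le> 14"
      using n by (intro ballI phase_height_slope[OF branch in_pi \<sigma> small]) auto
    then obtain H' where H': "\<And>z. z \<in> ?I \<Longrightarrow> (?H has_real_derivative H' z) (at z) \<and> \<bar>H' z\<bar> \<le> 14"
      by metis
    have "norm (?H x - ?H y) \<le> 14 * norm (x - y)"
    proof (rule field_differentiable_bound[of ?I])
      show "(?H has_real_derivative H' z) (at z within ?I)" if "z \<in> ?I" for z
        using H'[OF that] by (simp add: has_field_derivative_at_within)
    qed (use H' that in auto)
    then show ?thesis
      by simp
  qed
  have cos_Lip: "\<bar>cos (x / 2) - cos (y / 2)\<bar> \<le> 1 / 2 * \<bar>x - y\<bar>" for x y :: real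
  proof -
    have "norm (cos (x / 2) - cos (y / 2)) \<le> 1 / 2 * norm (x - y)"
    proof (rule field_differentiable_bound[of UNIV "\<lambda>x. cos (x / 2)" "\<lambda>x. - sin (x / 2) / 2"])
      show "((\<lambda>x. cos (x / 2)) has_real_derivative - sin (z / 2) / 2) (at z)" for z :: real
        by (auto intro!: derivative_eq_intros)
    qed auto
    then show ?thesis
      by simp
  qed
  show "\<exists>!x. x \<in> {d - pi / real (n + 3)<..<d + pi / real (n + 3)} \<and> x = d + 2 / real (n + 3) * \<theta> n x"
    unfolding N_def[symmetric]
  proof (rule unique_root_phase_equation[where L = 116])
    show "\<bar>\<theta> n x\<bar> < pi / 2" for x
      using arctan_bounded[of "?H x / cos (x / 2)"] unfolding \<theta>_def by linarith
    show "\<bar>\<theta> n x - \<theta> n y\<bar> \<le> 116 * \<bar>x - y\<bar>" if x: "x \<in> ?I" and y: "y \<in> ?I" for x y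
    proof -
      have "\<bar>\<theta> n x - \<theta> n y\<bar> \<le> 8 * (\<bar>cos (x / 2) - cos (y / 2)\<bar> + \<bar>?H x - ?H y\<bar>)"
        unfolding \<theta>_def
        using half_angle_pos[OF in_pi[OF x]] half_angle_pos[OF in_pi[OF y]] quarter[OF x] quarter[OF y]
        by (intro arctan_quotient_Lipschitz) auto
      also have "\<dots> \<le> 8 * (1 / 2 * \<bar>x - y\<bar> + 14 * \<bar>x - y\<bar>)"
        by (intro mult_left_mono add_mono H_Lip[OF x y] cos_Lip) simp
      finally show ?thesis
        by simp
    qed
  qed (use N in auto)
qed

lemma phase_root_asymptotics:
  obtains K where "\<And>n d J \<sigma>. n \<ge> 300 \<Longrightarrow> \<sigma>\<^sup>2 = 1 \<Longrightarrow>
     {d - pi / real (n + 3)..d + pi / real (n + 3)} \<subseteq> {0<..<pi} \<Longrightarrow>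
     J \<le> real (n + 3) * (d - pi / real (n + 3)) / 2 \<Longrightarrow> exp J / 2 > (real (n + 3) / 2)\<^sup>2 \<Longrightarrow>
     \<exists>x. (\<forall>y. y \<in> {d - pi / real (n + 3)<..<d + pi / real (n + 3)} \<and>
                y = d + 2 / real (n + 3) * arctan (phase_height \<beta> n \<sigma> y / cos (y / 2)) \<longleftrightarrow> y = x) \<and>
         \<bar>x - (d + 2 * coeff1 \<beta> d / real (n + 3) + 4 * coeff2 \<beta> d / (real (n + 3))\<^sup>2)\<bar> \<le> K / real n ^ 3"
proof -
  obtain M where M: "\<And>d. d \<in> {0<..<pi} \<Longrightarrow>
    \<exists>\<eta>'. (limit_phase has_real_derivative \<eta>') (at d) \<and> \<bar>\<eta>'\<bar> \<le> M \<and>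
    (\<forall>x\<in>{0<..<pi}. \<bar>limit_phase x - limit_phase d - \<eta>' * (x - d)\<bar> \<le> M * (x - d)\<^sup>2)"
    by (rule limit_phase_Taylor) blast
  define K where "K = 2 * (192 + M * pi\<^sup>2 + 2 * M * (192 + M * pi\<^sup>2 + M * pi))"
  have "M \<ge> 0"
    using M[of "pi / 2"] abs_ge_zero order_trans by fastforce
  then have K: "K \<ge> 0"
    by (simp add: K_def)
  show thesis
  proof (rule that[of K])
    fix n :: nat and d J \<sigma> :: real
    assume n: "n \<ge> 300" and \<sigma>: "\<sigma>\<^sup>2 = 1"
      and I: "{d - pi / real (n + 3)..d + pi / real (n + 3)} \<subseteq> {0<..<pi}"
      and J: "J \<le> real (n + 3) * (d - pi / real (n + 3)) / 2" "exp J / 2 > (real (n + 3) / 2)\<^sup>2"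
    define N where "N = real (n + 3)"
    let ?\<theta> = "\<lambda>x. arctan (phase_height \<beta> n \<sigma> x / cos (x / 2))"
    note root = perturbed_phase_equation[OF n \<sigma> I J]
    obtain x where x: "x \<in> {d - pi / N<..<d + pi / N}" "x = d + 2 / N * ?\<theta> x"
      and uniq: "\<And>y. y \<in> {d - pi / N<..<d + pi / N} \<and> y = d + 2 / N * ?\<theta> y \<Longrightarrow> y = x"
      using root(1) unfolding N_def[symmetric] by (elim ex1E conjE) blast
    have x_I: "x \<in> {d - pi / N..d + pi / N}"
      using x(1) by auto
    have N0: "N > 0"
      by (simp add: N_def)
    have d: "d \<in> {0<..<pi}" and x_pi: "x \<in> {0<..<pi}"
      using I x_I N0 by (auto simp: N_def subset_iff)
    obtain \<eta>' where \<eta>': "(limit_phase has_real_derivative \<eta>') (at d)" "\<bar>\<eta>'\<bar> \<le> M"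
      "\<bar>limit_phase x - limit_phase d - \<eta>' * (x - d)\<bar> \<le> M * (x - d)\<^sup>2"
      using M[OF d] x_pi by blast
    have "\<bar>x - (d + 2 * limit_phase d / N + 4 * (\<eta>' * limit_phase d) / N\<^sup>2)\<bar> \<le> K / N ^ 3"
      unfolding K_def
    proof (rule phase_equation_expansion[OF _ x(2) _ _ \<eta>'(3) \<eta>'(2)])
      show "\<bar>?\<theta> x\<bar> \<le> pi / 2"
        using arctan_bounded[of "phase_height \<beta> n \<sigma> x / cos (x / 2)"] by linarith
      show "\<bar>?\<theta> x - limit_phase x\<bar> \<le> 192 / N\<^sup>2"
        using root(2)[of x] x_I by (simp add: N_def)
    qed (simp add: N_def)
    also have "\<dots> \<le> K / real n ^ 3"
      using K n by (intro divide_left_mono power_mono mult_pos_pos) (auto simp: N_def)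
    finally have "\<bar>x - (d + 2 * coeff1 \<beta> d / N + 4 * coeff2 \<beta> d / N\<^sup>2)\<bar> \<le> K / real n ^ 3"
      by (simp only: coeff1_eq_limit_phase[OF d] coeff2_eq_limit_phase[OF d \<eta>'(1)])
    then show "\<exists>x. (\<forall>y. y \<in> {d - pi / real (n + 3)<..<d + pi / real (n + 3)} \<and>
                y = d + 2 / real (n + 3) * ?\<theta> y \<longleftrightarrow> y = x) \<and>
         \<bar>x - (d + 2 * coeff1 \<beta> d / real (n + 3) + 4 * coeff2 \<beta> d / (real (n + 3))\<^sup>2)\<bar> \<le> K / real n ^ 3"
      unfolding N_def[symmetric] using x uniq by (intro exI[of _ x]) blast
  qed
qed

end

section \<open>The two families of equations\<close>

lemma tan_eq_iff_arctan:
  fixes \<theta> F :: real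
  assumes "\<bar>\<theta>\<bar> < pi / 2"
  shows "tan \<theta> = F \<longleftrightarrow> \<theta> = arctan F"
proof
  have "arctan (tan \<theta>) = \<theta>"
    using assms by (intro arctan_tan) auto
  then show "\<theta> = arctan F" if "tan \<theta> = F"
    using that by simp
qed (simp add: tan_arctan)

lemma tan_shifted_eq_iff:
  fixes \<theta> F :: real
  assumes "\<bar>\<theta>\<bar> < pi / 2"
  shows "tan (\<theta> + real j * pi) = F \<longleftrightarrow> \<theta> = arctan F"
  using tan_eq_iff_arctan[OF assms] by (simp add: tan_periodic_nat)

lemma cos_eq_mult_sin_shifted_iff:
  fixes \<theta> h :: real
  assumes \<theta>: "\<bar>\<theta>\<bar> < pi / 2"
  shows "cos (\<theta> + pi / 2 + real j * pi) = h * sin (\<theta> + pi / 2 + real j * pi) \<longleftrightarrow> \<theta> = arctan (- h)"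
proof -
  have cos: "cos \<theta> > 0"
    using \<theta> by (intro cos_gt_zero_pi) auto
  have "cos (\<theta> + pi / 2 + real j * pi) = (- 1) ^ j * (- sin \<theta>)"
       "sin (\<theta> + pi / 2 + real j * pi) = (- 1) ^ j * cos \<theta>"
    by (simp_all add: cos_add sin_add cos_npi sin_npi mult.commute)
  then have "cos (\<theta> + pi / 2 + real j * pi) = h * sin (\<theta> + pi / 2 + real j * pi) \<longleftrightarrow> - sin \<theta> = h * cos \<theta>"
    by (simp only: mult.left_commute[of h] mult_cancel_left) simp
  also have "\<dots> \<longleftrightarrow> tan \<theta> = - h"
    using cos by (auto simp: tan_def field_simps)
  also have "\<dots> \<longleftrightarrow> \<theta> = arctan (- h)"
    by (rule tan_eq_iff_arctan[OF \<theta>])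
  finally show ?thesis .
qed

theorem theorem2p3:
  fixes \<beta> :: "real \<Rightarrow> complex"
  assumes "regular_branch \<beta>"
  shows "(\<exists>K. \<forall>\<^sub>F n in sequentially. \<forall>j\<in>{1..(n + 1) div 2}.
            exp (pi * (real j - 1)) / 2 > (real (n + 3) / 2)\<^sup>2 \<longrightarrow>
            \<bar>phi \<beta> n (2 * j - 1) -
               (d1 n j + 2 * coeff1 \<beta> (d1 n j) / real (n + 3)
                       + 4 * coeff2 \<beta> (d1 n j) / (real (n + 3))\<^sup>2)\<bar> \<le> K / real n ^ 3) \<and>
         (\<exists>K. \<forall>\<^sub>F n in sequentially. \<forall>j\<in>{1..n div 2}.
            exp (pi * (real j - 1)) / 2 > (real (n + 3) / 2)\<^sup>2 \<longrightarrow>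
            \<bar>phi \<beta> n (2 * j) -
               (d2 n j + 2 * coeff1 \<beta> (d2 n j) / real (n + 3)
                       + 4 * coeff2 \<beta> (d2 n j) / (real (n + 3))\<^sup>2)\<bar> \<le> K / real n ^ 3)"
proof -
  note branch = assms
  obtain K where K: "\<And>n d J \<sigma>. n \<ge> 300 \<Longrightarrow> \<sigma>\<^sup>2 = 1 \<Longrightarrow>
     {d - pi / real (n + 3)..d + pi / real (n + 3)} \<subseteq> {0<..<pi} \<Longrightarrow>
     J \<le> real (n + 3) * (d - pi / real (n + 3)) / 2 \<Longrightarrow> exp J / 2 > (real (n + 3) / 2)\<^sup>2 \<Longrightarrow>
     \<exists>x. (\<forall>y. y \<in> {d - pi / real (n + 3)<..<d + pi / real (n + 3)} \<and>
                y = d + 2 / real (n + 3) * arctan (phase_height \<beta> n \<sigma> y / cos (y / 2)) \<longleftrightarrow> y = x) \<and>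
         \<bar>x - (d + 2 * coeff1 \<beta> d / real (n + 3) + 4 * coeff2 \<beta> d / (real (n + 3))\<^sup>2)\<bar> \<le> K / real n ^ 3"
    by (rule phase_root_asymptotics[OF branch]) blast
  have phi_eq: "phi \<beta> n m = x"
    if d: "pi * real m / real (n + 3) = d - pi / real (n + 3)"
          "pi * real (m + 2) / real (n + 3) = d + pi / real (n + 3)"
      and I: "{d - pi / real (n + 3)..d + pi / real (n + 3)} \<subseteq> {0<..<pi}"
      and eq: "\<And>y. y \<in> {0<..<pi} \<Longrightarrow> y \<in> {d - pi / real (n + 3)<..<d + pi / real (n + 3)} \<Longrightarrow>
        (if odd m then tan (real (n + 3) / 2 * y) = f_fun \<beta> n y
         else cos (real (n + 3) / 2 * y) = h_fun \<beta> n y * sin (real (n + 3) / 2 * y)) \<longleftrightarrow>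
        y = d + 2 / real (n + 3) * arctan (phase_height \<beta> n \<sigma> y / cos (y / 2))"
      and x: "\<forall>y. y \<in> {d - pi / real (n + 3)<..<d + pi / real (n + 3)} \<and>
        y = d + 2 / real (n + 3) * arctan (phase_height \<beta> n \<sigma> y / cos (y / 2)) \<longleftrightarrow> y = x"
    for n m d \<sigma> x
  proof -
    have "y \<in> {0<..<pi}" if "y \<in> {d - pi / real (n + 3)<..<d + pi / real (n + 3)}" for y
      using I that by (auto simp: subset_iff)
    with eq x show ?thesis
      unfolding phi_def d by (intro the_equality) blast+
  qed
  have rescale: "N / 2 * (y - d) = t \<longleftrightarrow> y = d + 2 / N * t" if "N > 0" for N y d t :: real
    using that by (auto simp: field_simps)
  have offset: "\<bar>N / 2 * (y - d)\<bar> < pi / 2"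
    if "N > 0" "y \<in> {d - pi / N<..<d + pi / N}" for N y d :: real
  proof -
    have "\<bar>y - d\<bar> < pi / N"
      using that(2) by (simp add: abs_less_iff)
    then have "\<bar>y - d\<bar> * N < pi"
      using that(1) by (simp only: pos_less_divide_eq)
    then show ?thesis
      using that(1) by (simp add: abs_mult mult.commute)
  qed
  show ?thesis
  proof (intro conjI exI[of _ K] eventually_sequentiallyI[of 300] ballI impI)
    fix n j :: nat
    assume n: "n \<ge> 300" and j: "j \<in> {1..(n + 1) div 2}"
      and large: "exp (pi * (real j - 1)) / 2 > (real (n + 3) / 2)\<^sup>2"
    define N d where "N = real (n + 3)" and "d = d1 n j"
    have N: "N > 0"
      by (simp add: N_def)
    have d: "d = 2 * pi * real j / N"
      by (simp add: d_def d1_def N_def)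
    have ends: "d - pi / N = (2 * real j - 1) * pi / N" "d + pi / N = (2 * real j + 1) * pi / N"
      by (simp_all add: d algebra_simps add_divide_distrib diff_divide_distrib)
    have "2 * j \<le> n + 1"
      using j by auto
    then have "2 * real j \<le> real n + 1"
      by linarith
    then have "(2 * real j + 1) * pi < N * pi"
      by (intro mult_strict_right_mono) (auto simp: N_def)
    then have "d + pi / N < pi"
      using N by (simp add: ends divide_less_eq mult.commute)
    moreover have "d - pi / N > 0"
      using N j by (simp add: ends)
    ultimately have I: "{d - pi / N..d + pi / N} \<subseteq> {0<..<pi}"
      by auto
    have J: "pi * (real j - 1) \<le> N * (d - pi / N) / 2"
    proof -
      have "N * (d - pi / N) = (2 * real j - 1) * pi"
        using N by (simp add: ends)
      then show ?thesis
        by (simp only:) (simp add: algebra_simps)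
    qed
    obtain x where x: "\<forall>y. y \<in> {d - pi / N<..<d + pi / N} \<and>
        y = d + 2 / N * arctan (phase_height \<beta> n 1 y / cos (y / 2)) \<longleftrightarrow> y = x"
      and x_bound: "\<bar>x - (d + 2 * coeff1 \<beta> d / N + 4 * coeff2 \<beta> d / N\<^sup>2)\<bar> \<le> K / real n ^ 3"
      using K[OF n _ I[unfolded N_def] J[unfolded N_def] large, of 1] unfolding N_def by auto
    have "phi \<beta> n (2 * j - 1) = x"
    proof (rule phi_eq[where \<sigma> = 1, OF _ _ I[unfolded N_def] _ x[unfolded N_def]])
      show "pi * real (2 * j - 1) / real (n + 3) = d - pi / real (n + 3)"
           "pi * real (2 * j - 1 + 2) / real (n + 3) = d + pi / real (n + 3)"
        using j unfolding N_def[symmetric] ends by (simp_all add: of_nat_diff mult.commute)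
      fix y
      assume y: "y \<in> {0<..<pi}" "y \<in> {d - pi / real (n + 3)<..<d + pi / real (n + 3)}"
      \<comment> \<open>the interval is the image of \<open>(- \<pi>/2, \<pi>/2)\<close> under \<open>\<theta> \<mapsto> d + 2 \<theta> / N\<close>\<close>
      have "N / 2 * y = N / 2 * (y - d) + real j * pi"
        using N by (simp add: d field_simps)
      then have "tan (N / 2 * y) = f_fun \<beta> n y \<longleftrightarrow> y = d + 2 / N * arctan (f_fun \<beta> n y)"
        by (simp only: tan_shifted_eq_iff[OF offset[OF N y(2)[folded N_def]]] rescale[OF N])
      moreover have "f_fun \<beta> n y = phase_height \<beta> n 1 y / cos (y / 2)"
        unfolding phase_height_eq[OF branch y(1) one_power2] f_fun_def by simp
      ultimately show "(if odd (2 * j - 1) then tan (real (n + 3) / 2 * y) = f_fun \<beta> n y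
         else cos (real (n + 3) / 2 * y) = h_fun \<beta> n y * sin (real (n + 3) / 2 * y)) \<longleftrightarrow>
        y = d + 2 / real (n + 3) * arctan (phase_height \<beta> n 1 y / cos (y / 2))"
        using j by (simp only: N_def) simp
    qed
    then show "\<bar>phi \<beta> n (2 * j - 1) - (d1 n j + 2 * coeff1 \<beta> (d1 n j) / real (n + 3)
                       + 4 * coeff2 \<beta> (d1 n j) / (real (n + 3))\<^sup>2)\<bar> \<le> K / real n ^ 3"
      using x_bound by (simp only: N_def d_def)
  next
    fix n j :: nat
    assume n: "n \<ge> 300" and j: "j \<in> {1..n div 2}"
      and large: "exp (pi * (real j - 1)) / 2 > (real (n + 3) / 2)\<^sup>2"
    define N d where "N = real (n + 3)" and "d = d2 n j"
    have N: "N > 0"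
      by (simp add: N_def)
    have d: "d = (2 * real j + 1) * pi / N"
      by (simp add: d_def d2_def N_def)
    have ends: "d - pi / N = 2 * real j * pi / N" "d + pi / N = (2 * real j + 2) * pi / N"
      by (simp_all add: d algebra_simps add_divide_distrib diff_divide_distrib)
    have "2 * j \<le> n"
      using j by auto
    then have "2 * real j \<le> real n"
      by linarith
    then have "(2 * real j + 2) * pi < N * pi"
      by (intro mult_strict_right_mono) (auto simp: N_def)
    then have "d + pi / N < pi"
      using N by (simp add: ends divide_less_eq mult.commute)
    moreover have "d - pi / N > 0"
      using N j by (simp add: ends)
    ultimately have I: "{d - pi / N..d + pi / N} \<subseteq> {0<..<pi}"
      by auto
    have J: "pi * (real j - 1) \<le> N * (d - pi / N) / 2"
    proof -
      have "N * (d - pi / N) = (2 * real j) * pi"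
        using N by (simp add: ends)
      then show ?thesis
        by (simp only:) (simp add: algebra_simps)
    qed
    obtain x where x: "\<forall>y. y \<in> {d - pi / N<..<d + pi / N} \<and>
        y = d + 2 / N * arctan (phase_height \<beta> n (- 1) y / cos (y / 2)) \<longleftrightarrow> y = x"
      and x_bound: "\<bar>x - (d + 2 * coeff1 \<beta> d / N + 4 * coeff2 \<beta> d / N\<^sup>2)\<bar> \<le> K / real n ^ 3"
      using K[OF n _ I[unfolded N_def] J[unfolded N_def] large, of "- 1"] unfolding N_def by auto
    have "phi \<beta> n (2 * j) = x"
    proof (rule phi_eq[where \<sigma> = "- 1", OF _ _ I[unfolded N_def] _ x[unfolded N_def]])
      show "pi * real (2 * j) / real (n + 3) = d - pi / real (n + 3)"
           "pi * real (2 * j + 2) / real (n + 3) = d + pi / real (n + 3)"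
        unfolding N_def[symmetric] ends by (simp_all add: mult.commute)
      fix y
      assume y: "y \<in> {0<..<pi}" "y \<in> {d - pi / real (n + 3)<..<d + pi / real (n + 3)}"
      have "N / 2 * y = N / 2 * (y - d) + pi / 2 + real j * pi"
        using N by (simp add: d field_simps)
      then have "cos (N / 2 * y) = h_fun \<beta> n y * sin (N / 2 * y) \<longleftrightarrow> y = d + 2 / N * arctan (- h_fun \<beta> n y)"
        by (simp only: cos_eq_mult_sin_shifted_iff[OF offset[OF N y(2)[folded N_def]]] rescale[OF N])
      moreover have "- h_fun \<beta> n y = phase_height \<beta> n (- 1) y / cos (y / 2)"
      proof -
        have "- (2 * ((p - q) / r)) = 2 * ((- 1 * p + q) / r)" for p q r :: real
          by (simp add: diff_divide_distrib add_divide_distrib)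
        then show ?thesis
          using phase_height_eq[OF branch y(1), of "- 1" n] by (simp add: h_fun_def mult.assoc)
      qed
      ultimately show "(if odd (2 * j) then tan (real (n + 3) / 2 * y) = f_fun \<beta> n y
         else cos (real (n + 3) / 2 * y) = h_fun \<beta> n y * sin (real (n + 3) / 2 * y)) \<longleftrightarrow>
        y = d + 2 / real (n + 3) * arctan (phase_height \<beta> n (- 1) y / cos (y / 2))"
        by (simp only: N_def) simp
    qed
    then show "\<bar>phi \<beta> n (2 * j) - (d2 n j + 2 * coeff1 \<beta> (d2 n j) / real (n + 3)
                       + 4 * coeff2 \<beta> (d2 n j) / (real (n + 3))\<^sup>2)\<bar> \<le> K / real n ^ 3"
      using x_bound by (simp only: N_def d_def)
  qed
qed

end
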